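(* Let $P$ be a finite poset with $\hat 0$ and $\hat 1$, let $F_1,\dots,F_N$ be a lexicographic order on the facets of the order complex $\Delta(P)$, and consider the matching $M=\bigcup_k M_k$ on the faces of $\Delta(P)$ described in the context. Then each facet contributes at most one critical cell, i.e. for each $k$ at most one face in $F_k\setminus\bigcup_{i<k}F_i$ is unmatched. Moreover, for each $k$, the set of faces $F_k\setminus\bigcup_{i<k}F_i$ includes a critical cell exactly when the attachment of $F_k$ (passing from $\bigcup_{i<k}F_i$ to $\bigcup_{i\le k}F_i$) changes the homotopy type of the complex, i.e. exactly when every vertex of $F_k$ belongs to at least one of the intervals in $J(F_k)$.
   Context: Order complex and facets. $\Delta(P)$ is the simplicial complex whose faces are the chains (including the empty chain) of $P\setminus\{\hat 0,\hat 1\}$. Its facets correspond to the saturated chains $\hat 0=u_0\prec u_1\prec\cdots\prec u_s=\hat 1$ of $P$ ($\prec$ denotes a covering relation); the facet has vertices $u_1,\dots,u_{s-1}$, and the rank of $u_i$ within that facet is $i$. $P$ is not assumed graded. A facet is also identified with the set of all its faces, so $F_k\setminus\bigcup_{i<k}F_i$ is the set of faces contained in $F_k$ but in no $F_i$ with $i<k$, and $F_k\cap\bigcup_{i<k}F_i$ is the complex of faces of $F_k$ lying in some earlier facet. Lexicographic order. A total order on the facets of $\Delta(P)$ such that: whenever facets $F,F'$ have the same elements at ranks $1,\dots,i$ (for some $i\ge 0$) but different elements at rank $i+1$, and $F$ precedes $F'$, then every facet containing the elements of $F$ at ranks $1,\dots,i+1$ precedes every facet containing the elements of $F'$ at ranks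 $1,\dots,i+1$. Interval systems. For a lexicographic order, each inclusion-maximal face of $F_k\cap\bigcup_{i<k}F_i$ is obtained from $F_k$ by deleting the vertices in a nonempty set of consecutive ranks of $F_k$. These deleted sets are the minimal skipped intervals of $F_k$; $I(F_k)$ is the set of them ($I(F_1)=\emptyset$). The set $J(F_k)$ of pairwise disjoint intervals is obtained from $I:=I(F_k)$, starting with $J=\emptyset$, by repeating the following until $I=\emptyset$: (1) add to $J$ the interval of $I$ whose lowest element has smallest rank; (2) remove this interval from $I$ and replace every other interval of $I$ by its intersection with the set of ranks strictly above all ranks of the interval just added; (3) delete from $I$ every interval that properly contains another interval of $I$. Write $J(F_k)=\{j_1,\dots,j_r\}$ in increasing order of rank, and let $\rho_i$ be the lowest-rank element of $j_i$. The matching pairs $M_k$ (on the faces of $F_k\setminus\bigcup_{i<k}F_i$, the empty face being included among the faces of $\Delta(P)$). (i) If some vertex of $F_k$ lies in no interval of $I(F_k)$, let $\rho_0$ be the lowest-rank such vertex; $M_k$ consists of the pairs $\{h\setminus\{\rho_0\},h\}$ for all faces $h\in F_k\setminus\bigcup_{i<k}F_i$ with $\rho_0\in h$. (ii) Otherwise, for a face $h\in F_k\setminus\bigcup_{i<k}F_i$ let $\tau(h)=\min\{i: 1\le i\le r,\ h\cap j_i\ne\{\rho_i\}\}$, with $\tau(h)=\infty$ if this set is empty. If $\tau(h)<\infty$, pair $h$ with $h\setminus\{\rho_{\tau(h)}\}$ if $\rho_{\tau(h)}\in h$ and with $h\cup\{\rho_{\tau(h)}\}$ otherwise. If $\tau(h)=\infty$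 and some vertex of $F_k$ lies in no interval of $J(F_k)$, let $\rho_{r+1}$ be the lowest-rank such vertex, and pair $h$ with $h\setminus\{\rho_{r+1}\}$ if $\rho_{r+1}\in h$ and with $h\cup\{\rho_{r+1}\}$ otherwise. If $\tau(h)=\infty$ and every vertex of $F_k$ lies in some interval of $J(F_k)$, then $h$ is left unpaired. Critical cells are the faces of $\Delta(P)$ (possibly the empty face) that are unmatched in $M$.
   Formalization: For k = 1, the void complex before attaching F_1 (without even the empty face) is regarded as contractible, i.e. as a point; if it is read as the empty space, the homotopy-type equivalence fails at k = 1. Nothing changes for k ≥ 2. *)

theory Defs
  imports "HOL-Analysis.Analysis" "HOL-Library.While_Combinator"
begin

text \<open>
  A finite poset with least and greatest element is a type of sort
  \<open>{finite, order_bot, order_top}\<close>. Simplicial complexes are sets of faces that may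
  contain the empty face; the void complex \<open>{}\<close> and the complex \<open>{{}}\<close> are different.
\<close>

definition order_complex :: "'a::{finite,order_bot,order_top} set set" where
  "order_complex = {A. A \<subseteq> UNIV - {bot, top} \<and> Complete_Partial_Order.chain (\<le>) A}"

definition facets :: "'a::{finite,order_bot,order_top} set set" where
  "facets = {A \<in> order_complex. \<forall>B \<in> order_complex. A \<subseteq> B \<longrightarrow> A = B}"

text \<open>
  If \<open>bot = u\<^sub>0 < u\<^sub>1 < \<dots> < u\<^sub>s = top\<close> is the saturated chain of the facet
  \<open>F = {u\<^sub>1, \<dots>, u\<^sub>s\<^sub>-\<^sub>1}\<close>, then \<open>u\<^sub>i\<close> has rank \<open>i\<close> in \<open>F\<close>. Along a facet the order of the
  poset and the order by rank agree, so below "lowest rank" is expressed by \<open>LEAST\<close>.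
\<close>

definition rank_in :: "'a::order set \<Rightarrow> 'a \<Rightarrow> nat" where
  "rank_in F u = card {v \<in> F. v \<le> u}"

definition vertex_at :: "'a::order set \<Rightarrow> nat \<Rightarrow> 'a" where
  "vertex_at F i = (THE u. u \<in> F \<and> rank_in F u = i)"

definition lexicographic_order ::
    "(nat \<Rightarrow> 'a::{finite,order_bot,order_top} set) \<Rightarrow> nat \<Rightarrow> bool" where
  "lexicographic_order F N \<longleftrightarrow>
     bij_betw F {1..N} facets \<and>
     (\<forall>a \<in> {1..N}. \<forall>b \<in> {1..N}. \<forall>i.
        i < card (F a) \<and> i < card (F b) \<and>
        (\<forall>l \<in> {1..i}. vertex_at (F a) l = vertex_at (F b) l) \<and>
        vertex_at (F a) (Suc i) \<noteq> vertex_at (F b) (Suc i) \<and>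
        a < b \<longrightarrow>
        (\<forall>c \<in> {1..N}. \<forall>d \<in> {1..N}.
           vertex_at (F a) ` {1..Suc i} \<subseteq> F c \<and>
           vertex_at (F b) ` {1..Suc i} \<subseteq> F d \<longrightarrow> c < d))"

definition earlier_complex :: "(nat \<Rightarrow> 'a set) \<Rightarrow> nat \<Rightarrow> 'a set set" where
  "earlier_complex F k = (\<Union>i \<in> {1..<k}. Pow (F i))"

definition new_faces :: "(nat \<Rightarrow> 'a set) \<Rightarrow> nat \<Rightarrow> 'a set set" where
  "new_faces F k = Pow (F k) - earlier_complex F k"

definition I_intervals :: "(nat \<Rightarrow> 'a set) \<Rightarrow> nat \<Rightarrow> 'a set set" where
  "I_intervals F k =
     {F k - G | G. G \<in> Pow (F k) \<inter> earlier_complex F k \<and>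
        (\<forall>H \<in> Pow (F k) \<inter> earlier_complex F k. G \<subseteq> H \<longrightarrow> G = H)}"

definition lowest :: "'a::order set \<Rightarrow> 'a" where
  "lowest A = (LEAST x. x \<in> A)"

definition first_interval :: "'a::order set set \<Rightarrow> 'a set" where
  "first_interval I = (THE A. A \<in> I \<and> (\<forall>B \<in> I. lowest A \<le> lowest B))"

definition truncate_above :: "'a::order set \<Rightarrow> 'a set set \<Rightarrow> 'a set set" where
  "truncate_above A I = (\<lambda>B. {x \<in> B. \<forall>y \<in> A. y < x}) ` I"

definition minimal_members :: "'a set set \<Rightarrow> 'a set set" where
  "minimal_members I = {B \<in> I. \<not> (\<exists>C \<in> I. C \<subset> B)}"

definition disjoint_intervals :: "'a::order set set \<Rightarrow> 'a set set" where
  "disjoint_intervals I0 =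
     snd (while (\<lambda>(I, J). I \<noteq> {})
            (\<lambda>(I, J). let A = first_interval I in
               (minimal_members (truncate_above A (I - {A})), insert A J))
            (I0, {}))"

definition J_intervals :: "(nat \<Rightarrow> 'a::order set) \<Rightarrow> nat \<Rightarrow> 'a set set" where
  "J_intervals F k = disjoint_intervals (I_intervals F k)"

text \<open>The intervals \<open>j\<^sub>1, \<dots>, j\<^sub>r\<close> and their lowest elements \<open>\<rho>\<^sub>1, \<dots>, \<rho>\<^sub>r\<close>.\<close>

definition nth_interval :: "'a::order set set \<Rightarrow> nat \<Rightarrow> 'a set" where
  "nth_interval J i = (THE A. A \<in> J \<and> card {B \<in> J. lowest B \<le> lowest A} = i)"

definition rho :: "'a::order set set \<Rightarrow> nat \<Rightarrow> 'a" where
  "rho J i = lowest (nth_interval J i)"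

text \<open>\<open>\<tau>(h)\<close> is the minimum of the following set, and infinite if the set is empty.\<close>

definition tau_set :: "'a::order set set \<Rightarrow> 'a set \<Rightarrow> nat set" where
  "tau_set J h = {i \<in> {1..card J}. h \<inter> nth_interval J i \<noteq> {rho J i}}"

definition lowest_uncovered :: "'a::order set \<Rightarrow> 'a set set \<Rightarrow> 'a" where
  "lowest_uncovered A S = (LEAST v. v \<in> A \<and> v \<notin> \<Union>S)"

definition toggle :: "'a \<Rightarrow> 'a set \<Rightarrow> 'a set" where
  "toggle v h = (if v \<in> h then h - {v} else h \<union> {v})"

definition matching_pairs :: "(nat \<Rightarrow> 'a::order set) \<Rightarrow> nat \<Rightarrow> 'a set set set" where
  "matching_pairs F k =
     (let I = I_intervals F k; J = J_intervals F k in
      if \<exists>v \<in> F k. v \<notin> \<Union>I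
      then {{h - {lowest_uncovered (F k) I}, h} | h.
              h \<in> new_faces F k \<and> lowest_uncovered (F k) I \<in> h}
      else {{h, toggle (rho J (Min (tau_set J h))) h} | h.
              h \<in> new_faces F k \<and> tau_set J h \<noteq> {}} \<union>
           {{h, toggle (lowest_uncovered (F k) J) h} | h.
              h \<in> new_faces F k \<and> tau_set J h = {} \<and> (\<exists>v \<in> F k. v \<notin> \<Union>J)})"

definition critical_cells ::
    "(nat \<Rightarrow> 'a::{finite,order_bot,order_top} set) \<Rightarrow> nat \<Rightarrow> 'a set set" where
  "critical_cells F N = {h \<in> order_complex. h \<notin> \<Union>(\<Union>k \<in> {1..N}. matching_pairs F k)}"

text \<open>
  Geometric realization in barycentric coordinates, in the product topology on
  \<open>'a \<Rightarrow> real\<close> (the usual topology, as the vertex set is finite). The complex \<open>{{}}\<close>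
  has empty realization. As is customary when the empty face counts as a face, the void
  complex is regarded as contractible; it is given a one-point realization. This only
  concerns the attachment of the first facet.
\<close>

definition realization :: "'a::finite set set \<Rightarrow> ('a \<Rightarrow> real) topology" where
  "realization K =
     (if K = {} then top_of_set {\<lambda>_. 0}
      else top_of_set {x. (\<forall>v. 0 \<le> x v) \<and> (\<Sum>v \<in> UNIV. x v) = 1 \<and> {v. x v \<noteq> 0} \<in> K})"

definition attachment_changes_homotopy_type ::
    "(nat \<Rightarrow> 'a::finite set) \<Rightarrow> nat \<Rightarrow> bool" where
  "attachment_changes_homotopy_type F k \<longleftrightarrow>
     \<not> realization (earlier_complex F k) homotopy_equivalent_space
         realization (earlier_complex F (Suc k))"

end

theory Submission
  imports Defs "HOL-Homology.Homology"
begin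

text \<open>
  In a lexicographic order two facets can be spliced where they meet again, so every maximal
  face of \<open>F\<^sub>k\<close> in an earlier facet omits an interval of \<open>F\<^sub>k\<close>, and a face of \<open>F\<^sub>k\<close> is new
  iff it meets every interval of \<open>I(F\<^sub>k)\<close>. If a face meets the first interval exactly in its
  lowest element, it meets no other interval there, so it is new iff it meets the truncated
  intervals. Hence toggling \<open>\<rho>\<^sub>\<tau>\<close> preserves both newness and \<open>\<tau>\<close>, and the only face that can
  remain unpaired is \<open>{\<rho>\<^sub>1, \<dots>, \<rho>\<^sub>r}\<close>, when \<open>J(F\<^sub>k)\<close> covers \<open>F\<^sub>k\<close>.

  The new faces with \<open>\<tau> = i\<close> are paired by toggling one vertex, so they can be collapsed away
  for \<open>i = 1, \<dots>, r\<close> in turn. What is left is either the earlier complex, or the earlier complex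
  with one simplex of dimension \<open>d\<close> attached along its boundary. In the latter case the homotopy
  type changes: the relative homology is infinite cyclic in degree \<open>d\<close>, so by exactness the
  rank grows in degree \<open>d\<close> or drops in degree \<open>d - 1\<close>.
\<close>

(* The constant top of HOL-Algebra would shadow the greatest element of the poset. *)
hide_const (open) Order.top

section \<open>Collapses\<close>

text \<open>Homotopy types are told apart by singular homology, so the effect of an attached simplex
  \<open>\<sigma>\<close> has to come from exact sequences and excision. The relative groups turn
  out to depend on \<open>\<sigma>\<close> alone; hence they may be computed inside
  \<open>Pow \<sigma>\<close>, where \<open>\<sigma>\<close> collapses onto its boundary without one
  face of codimension one, and a connecting map lowers the dimension by one, down to a point. A
  growing rank contradicts an isomorphism only if ranks are finite; that follows by building a
  complex up one maximal face at a time with the same exact sequence.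

  The empty face takes part in the matching. Pairing it with a vertex collapses a one-vertex complex
  onto the void complex, which fits the realization of the latter by a point; an unpaired empty face
  turns the void complex into \<open>{{}}\<close>, whose realization is empty. Both situations are
  treated apart.

  Case (i) of the matching matters only for counting critical cells. The topological argument always
  goes through the levels of \<open>\<tau>\<close>, because a vertex outside all of \<open>I\<close>
  is also outside all of \<open>J\<close>.\<close>

lemma straight_line_retraction:
  fixes S T :: "('a::finite \<Rightarrow> real) set"
  assumes "S \<subseteq> T" "continuous_on T r" "r \<in> T \<rightarrow> S" "\<And>x. x \<in> S \<Longrightarrow> r x = x"
    and seg: "\<And>x t. x \<in> T \<Longrightarrow> 0 \<le> t \<Longrightarrow> t \<le> 1 \<Longrightarrow> (\<lambda>u. (1 - t) * r x u + t * x u) \<in> T"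
  shows "top_of_set S homotopy_equivalent_space top_of_set T"
    and "trivial_group (relative_homology_group p (top_of_set T) S)"
proof -
  \<comment> \<open>Runs from \<open>r\<close> at \<open>t = 0\<close> to the identity at
    \<open>t = 1\<close>. In the product topology its continuity is checked one coordinate at a
    time.\<close>
  let ?h = "\<lambda>(t, x). (\<lambda>u. (1 - t) * r x u + t * x u)"
  have *: "continuous_on ({0..1} \<times> T) (\<lambda>z. r (snd z) u)" for u
    by (rule continuous_on_compose2[OF continuous_on_product_then_coordinatewise[OF assms(2)]])
      (auto intro: continuous_intros)
  have **: "continuous_on ({0..1} \<times> T) (\<lambda>z. snd z u)" for u
    by (rule continuous_on_product_then_coordinatewise) (auto intro: continuous_intros)
  have "continuous_on ({0..1} \<times> T) ?h"
    unfolding case_prod_unfold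
    by (intro continuous_on_coordinatewise_then_product continuous_intros * **)
  then have "homotopic_with_canon (\<lambda>_. True) T T r id"
    unfolding homotopic_with_def
    by (intro exI[of _ ?h])
       (use seg in \<open>auto simp: prod_topology_subtopology_eu Pi_iff\<close>)
  moreover have ST: "subtopology (top_of_set T) S = top_of_set S"
    using assms(1) by (simp add: subtopology_subtopology Int_absorb1)
  moreover have cr: "continuous_map (top_of_set T) (top_of_set S) r"
    using assms by auto
  moreover have rid: "homotopic_with_canon (\<lambda>_. True) S S r id"
    using assms by (intro homotopic_with_equal) (auto intro: continuous_on_subset)
  ultimately show "trivial_group (relative_homology_group p (top_of_set T) S)"
    by (intro trivial_relative_homology_group_gen[of _ _ r]) auto
  have "continuous_map (top_of_set S) (top_of_set T) id"
    using assms(1) by auto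
  then show "top_of_set S homotopy_equivalent_space top_of_set T"
    unfolding homotopy_equivalent_space_def
    using cr rid \<open>homotopic_with_canon (\<lambda>_. True) T T r id\<close>
    by (intro exI[of _ id] exI[of _ r]) auto
qed

text \<open>Links the void complex, realized by the zero function, with a one-vertex complex,
  realized by a unit vector.\<close>

lemma homotopy_equivalent_singletons:
  "top_of_set {a} homotopy_equivalent_space top_of_set {b}"
  unfolding homotopy_equivalent_space_def
  by (intro exI[of _ "\<lambda>_. b"] exI[of _ "\<lambda>_. a"] conjI homotopic_with_equal) auto

text \<open>The point set without the exception for the void complex: both \<open>{}\<close> and
  \<open>{{}}\<close> give the empty set. Homology is computed with it.\<close>

definition real_set :: "'a::finite set set \<Rightarrow> ('a \<Rightarrow> real) set" where
  "real_set K = {x. (\<forall>v. 0 \<le> x v) \<and> (\<Sum>v \<in> UNIV. x v) = 1 \<and> {v. x v \<noteq> 0} \<in> K}"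

lemma realization_eq: "K \<noteq> {} \<Longrightarrow> realization K = top_of_set (real_set K)"
  by (simp add: realization_def real_set_def)

definition face_closed :: "'a set set \<Rightarrow> bool" where
  "face_closed K \<longleftrightarrow> (\<forall>A \<in> K. Pow A \<subseteq> K)"

lemma face_closedD: "face_closed K \<Longrightarrow> A \<in> K \<Longrightarrow> B \<subseteq> A \<Longrightarrow> B \<in> K"
  by (auto simp: face_closed_def)

text \<open>On points of a complex it is positive exactly where the support contains
  \<open>A\<close>, so it measures the distance to the boundary within a simplex.\<close>

definition min_coord :: "'a::finite set \<Rightarrow> ('a \<Rightarrow> real) \<Rightarrow> real" where
  "min_coord A x = Min (x ` A)"

lemma continuous_on_min_coord:
  assumes "A \<noteq> {}"
  shows "continuous_on S (min_coord A)"
proof -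
  have "finite A" by simp
  then have "continuous_on S (\<lambda>x. Min (x ` A))"
    using assms
  proof (induction A rule: finite_ne_induct)
    case (singleton a)
    show ?case by (auto intro: continuous_intros continuous_on_subset[OF continuous_on_product_coordinates])
  next
    case (insert a A)
    then show ?case
      by (auto intro!: continuous_intros intro: continuous_on_subset[OF continuous_on_product_coordinates])
  qed
  then show ?thesis by (simp add: min_coord_def[abs_def])
qed

lemma min_coord_le: "u \<in> A \<Longrightarrow> min_coord A x \<le> x u"
  by (simp add: min_coord_def)

lemma min_coord_attained: "A \<noteq> {} \<Longrightarrow> \<exists>u \<in> A. min_coord A x = x u"
  using Min_in[of "x ` A"] by (fastforce simp: min_coord_def)

lemma min_coord_eq_0_iff:
  assumes "A \<noteq> {}" "\<And>v. 0 \<le> x v"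
  shows "min_coord A x = 0 \<longleftrightarrow> \<not> A \<subseteq> {v. x v \<noteq> 0}"
  using assms min_coord_le[of _ A x] min_coord_attained[of A x]
  by (smt (verit) mem_Collect_eq subset_eq)

lemma min_coord_nonneg: "A \<noteq> {} \<Longrightarrow> (\<And>v. 0 \<le> x v) \<Longrightarrow> 0 \<le> min_coord A x"
  by (metis min_coord_attained)

text \<open>The retraction lowers the coordinates in \<open>\<sigma>\<close> by the least of them and moves their mass to \<open>v\<close>.\<close>

lemma elementary_collapse:
  fixes Y :: "'a::finite set set"
  assumes Y: "face_closed Y" and v: "v \<notin> \<sigma>" "insert v \<sigma> \<in> Y" and "\<sigma> \<noteq> {}"
    and free: "\<And>h. h \<in> Y \<Longrightarrow> \<sigma> \<subseteq> h \<Longrightarrow> h = \<sigma> \<or> h = insert v \<sigma>"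
  defines "X \<equiv> Y - {\<sigma>, insert v \<sigma>}"
  shows "realization X homotopy_equivalent_space realization Y"
    and "trivial_group (relative_homology_group p (top_of_set (real_set Y)) (real_set X))"
proof -
  let ?m = "min_coord \<sigma>"
  define r where "r = (\<lambda>x u. x u - (if u \<in> \<sigma> then ?m x else 0) + (if u = v then card \<sigma> * ?m x else 0))"
  have "continuous_on (real_set Y) (\<lambda>x. if P then ?m x else 0)"
    "continuous_on (real_set Y) (\<lambda>x. if P then c * ?m x else 0)" for P c
    using \<open>\<sigma> \<noteq> {}\<close> by (cases P; simp add: continuous_on_min_coord continuous_on_mult_left)+
  then have cont: "continuous_on (real_set Y) r"
    unfolding r_def
    by (intro continuous_on_coordinatewise_then_product continuous_intros)
       (auto intro: continuous_on_subset[OF continuous_on_product_coordinates])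
  have m0: "0 \<le> ?m x" if "x \<in> real_set Y" for x
    using that \<open>\<sigma> \<noteq> {}\<close> by (auto intro!: min_coord_nonneg simp: real_set_def)
  have r0: "r x = x" if "?m x = 0" for x
    using that by (auto simp: r_def)
  have sumr: "sum (r x) UNIV = sum x UNIV" for x
    by (simp add: r_def sum.distrib sum_subtractf flip: sum.inter_filter)
  have rnn: "0 \<le> r x u" if "x \<in> real_set Y" for x u
    using that min_coord_le[of u \<sigma> x] m0[OF that] v(1) by (auto simp: r_def real_set_def)
  \<comment> \<open>A point moves only if its support contains \<open>\<sigma>\<close>; freeness
    leaves just the two open simplices that are to be removed.\<close>
  have supp: "{u. x u \<noteq> 0} = \<sigma> \<or> {u. x u \<noteq> 0} = insert v \<sigma>" if "x \<in> real_set Y" "?m x \<noteq> 0" for x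
    using that \<open>\<sigma> \<noteq> {}\<close> by (intro free) (auto simp: real_set_def min_coord_eq_0_iff)
  have XY: "real_set X \<subseteq> real_set Y"
    by (auto simp: X_def real_set_def)
  have inX: "x \<in> real_set X \<longleftrightarrow> ?m x = 0" if "x \<in> real_set Y" for x
    using that supp[OF that] \<open>\<sigma> \<noteq> {}\<close> by (auto simp: X_def real_set_def min_coord_eq_0_iff)
  have seg: "(\<lambda>u. (1 - t) * r x u + t * x u) \<in> real_set Y" if "x \<in> real_set Y" "0 \<le> t" "t \<le> 1" for x t
  proof (cases "?m x = 0")
    case True
    then have "(\<lambda>u. (1 - t) * r x u + t * x u) = x"
      by (simp add: r0 algebra_simps)
    then show ?thesis using that by simp
  next
    case False
    then have "{u. x u \<noteq> 0} \<subseteq> insert v \<sigma>"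
      using supp[OF that(1)] by blast
    then have "x u = 0" if "u \<notin> insert v \<sigma>" for u
      using that by blast
    then have "(1 - t) * r x u + t * x u = 0" if "u \<notin> insert v \<sigma>" for u
      using that by (simp add: r_def)
    then have "{u. (1 - t) * r x u + t * x u \<noteq> 0} \<subseteq> insert v \<sigma>"
      by blast
    then have "{u. (1 - t) * r x u + t * x u \<noteq> 0} \<in> Y"
      using face_closedD[OF Y v(2)] by blast
    moreover have "(\<Sum>u\<in>UNIV. (1 - t) * r x u + t * x u) = 1"
      using that by (simp add: sum.distrib sumr flip: sum_distrib_left) (simp add: real_set_def)
    ultimately show ?thesis
      using that rnn[OF that(1)] by (auto simp: real_set_def)
  qed
  have rX: "r x \<in> real_set X" if "x \<in> real_set Y" for x
  proof -
    have "r x \<in> real_set Y"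
      using seg[of x 0] that by simp
    \<comment> \<open>A coordinate in \<open>\<sigma>\<close> that attains the minimum is lowered to
      0, and it differs from \<open>v\<close>, so it receives no mass.\<close>
    moreover obtain u where "u \<in> \<sigma>" "?m x = x u"
      using min_coord_attained \<open>\<sigma> \<noteq> {}\<close> by blast
    then have "r x u = 0" "u \<in> \<sigma>"
      using v(1) by (auto simp: r_def)
    then have "?m (r x) = 0"
      using rnn[OF that] \<open>\<sigma> \<noteq> {}\<close> by (subst min_coord_eq_0_iff) auto
    ultimately show ?thesis using inX by blast
  qed
  have "r x = x" if "x \<in> real_set X" for x
    using that inX XY r0 by blast
  note * = straight_line_retraction[OF XY cont _ this seg]
  show "trivial_group (relative_homology_group p (top_of_set (real_set Y)) (real_set X))"
    using rX by (intro *) auto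
  \<comment> \<open>With the empty face present, neither realization falls under the convention for
    the void complex.\<close>
  have "{} \<in> X"
    using \<open>\<sigma> \<noteq> {}\<close> v face_closedD[OF Y v(2)] by (auto simp: X_def)
  then have "realization X = top_of_set (real_set X)" "realization Y = top_of_set (real_set Y)"
    using v by (auto intro!: realization_eq)
  then show "realization X homotopy_equivalent_space realization Y"
    using * rX by auto
qed

lemma realization_Pow_vertex: "realization {{}, {v}} = top_of_set {\<lambda>u. if u = v then 1 else 0}"
proof -
  have "real_set {{}, {v}} = {\<lambda>u. if u = v then 1 else 0}"
  proof safe
    fix x assume x: "x \<in> real_set {{}, {v}}"
    then have *: "x u = 0" if "u \<noteq> v" for u
      using that by (auto simp: real_set_def)
    then have "x v = sum x UNIV"
      by (simp add: sum.remove[of UNIV v])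
    then show "x = (\<lambda>u. if u = v then 1 else 0)"
      using x * by (auto simp: real_set_def)
  qed (auto simp: real_set_def)
  then show ?thesis by (simp add: realization_eq)
qed

text \<open>Induction on the number of new faces: a largest new face \<open>h\<close> contains \<open>v\<close>, and
  \<open>h - {v}\<close> is a free face of it.\<close>

lemma collapse_matched_by_vertex:
  fixes Y :: "'a::finite set set"
  assumes "face_closed X" "face_closed Y" "X \<subseteq> Y" "\<And>h. h \<in> Y - X \<Longrightarrow> toggle v h \<in> Y - X"
  shows "realization X homotopy_equivalent_space realization Y"
  using assms
proof (induction "card (Y - X)" arbitrary: Y rule: less_induct)
  case less
  show ?case
  proof (cases "Y - X = {}")
    case True
    then have "X = Y" using less.prems by blast
    then show ?thesis by (simp add: homotopy_equivalent_space_refl)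
  next
    case False
    obtain h where h: "h \<in> Y - X" and max: "\<And>g. g \<in> Y - X \<Longrightarrow> card g \<le> card h"
      using Max_in[of "card ` (Y - X)"] Max_ge[of "card ` (Y - X)"] False by fastforce
    have vh: "v \<in> h"
    proof (rule ccontr)
      assume "v \<notin> h"
      then have "insert v h \<in> Y - X" using less.prems(4)[OF h] by (simp add: toggle_def)
      then show False using max[of "insert v h"] \<open>v \<notin> h\<close> by simp
    qed
    define \<sigma> where "\<sigma> = h - {v}"
    have \<sigma>: "\<sigma> \<in> Y - X" "insert v \<sigma> = h" "v \<notin> \<sigma>"
      using less.prems(4)[OF h] vh by (auto simp: toggle_def \<sigma>_def)
    \<comment> \<open>\<open>g\<close> is not in \<open>X\<close>, which is face-closed and lacks
      \<open>\<sigma>\<close>. So \<open>insert v g\<close> is new, contains \<open>h\<close>, and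
      equals it because \<open>h\<close> has maximal size.\<close>
    have free: "g = \<sigma> \<or> g = insert v \<sigma>" if "g \<in> Y" "\<sigma> \<subseteq> g" for g
    proof -
      have g: "g \<in> Y - X" using that \<sigma> face_closedD[OF less.prems(1)] by blast
      then have "insert v g \<in> Y - X"
        using less.prems(4)[OF g] by (cases "v \<in> g") (auto simp: toggle_def insert_absorb)
      then have "insert v g = h"
        using max[of "insert v g"] \<open>\<sigma> \<subseteq> g\<close> \<sigma>(2)
        by (metis card_seteq finite insert_mono)
      then show ?thesis using that \<sigma> by auto
    qed
    let ?Y = "Y - {\<sigma>, insert v \<sigma>}"
    have "realization X homotopy_equivalent_space realization ?Y"
    proof (rule less.hyps)
      show "card (?Y - X) < card (Y - X)"
        using \<sigma> by (intro psubset_card_mono) auto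
      show "face_closed ?Y"
        unfolding face_closed_def
      proof (intro ballI subsetI)
        fix A B assume AB: "A \<in> ?Y" "B \<in> Pow A"
        then have "B \<in> Y" using face_closedD[OF less.prems(2)] by blast
        then show "B \<in> ?Y" using free[of A] AB by auto
      qed
      show "X \<subseteq> ?Y" using less.prems(3) h \<sigma> by auto
      fix g assume g: "g \<in> ?Y - X"
      then have "toggle v g \<in> Y - X" using less.prems(4) by blast
      \<comment> \<open>Toggling is an involution that exchanges the two removed faces, so no other
        face is sent to them.\<close>
      moreover have "toggle v g \<noteq> \<sigma>" "toggle v g \<noteq> insert v \<sigma>"
        using g \<sigma>(3) by (auto simp: toggle_def split: if_splits)
      ultimately show "toggle v g \<in> ?Y - X" by blast
    qed (use less.prems in auto)
    also have "realization ?Y homotopy_equivalent_space realization Y"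
    proof (cases "\<sigma> = {}")
      case True
      \<comment> \<open>The removed pair is \<open>{}\<close> and \<open>{v}\<close>, and what is
        left is void. The one-point realization makes this a homotopy equivalence too.\<close>
      then have Y: "Y = {{}, {v}}" using free \<sigma> h by auto
      show ?thesis unfolding Y using True
        by (simp add: realization_Pow_vertex)
           (simp add: realization_def homotopy_equivalent_singletons)
    next
      case False
      show ?thesis
        using h \<sigma> by (intro elementary_collapse(1) less.prems free False) auto
    qed
    finally show ?thesis .
  qed
qed

section \<open>Rank of abelian groups\<close>

text \<open>Linear independence over the integers in multiplicative notation. An indexed family,
  unlike a set, is carried along any map without a question of injectivity.\<close>

definition independent_family ::
    "('a, 'b) monoid_scheme \<Rightarrow> 'i set \<Rightarrow> ('i \<Rightarrow> 'a) \<Rightarrow> bool" where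
  "independent_family G I b \<longleftrightarrow> b \<in> I \<rightarrow> carrier G \<and>
     (\<forall>c :: 'i \<Rightarrow> int. finprod G (\<lambda>i. b i [^]\<^bsub>G\<^esub> c i) I = \<one>\<^bsub>G\<^esub> \<longrightarrow> (\<forall>i \<in> I. c i = 0))"

text \<open>Lower bounds replace the rank itself, so infinite rank needs no value. Indices are
  natural numbers because a definition cannot quantify over index types.\<close>

definition rank_ge :: "('a, 'b) monoid_scheme \<Rightarrow> nat \<Rightarrow> bool" where
  "rank_ge G n \<longleftrightarrow> (\<exists>(I :: nat set) b. finite I \<and> card I = n \<and> independent_family G I b)"

lemma rank_geE:
  assumes "rank_ge G n"
  obtains I :: "nat set" and b where "finite I" "card I = n" "independent_family G I b"
  using assms unfolding rank_ge_def by blast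

lemma hom_finprod_comm_group:
  assumes "comm_group G" "comm_group H" "f \<in> hom G H" "b \<in> I \<rightarrow> carrier G"
  shows "f (finprod G b I) = finprod H (\<lambda>i. f (b i)) I"
proof -
  interpret G: comm_group G by fact
  interpret H: comm_group H by fact
  interpret group_hom G H f using assms by unfold_locales
  show ?thesis
  proof (cases "finite I")
    case True
    then show ?thesis
      using assms(4) by (induction I rule: finite_induct) (auto simp: Pi_iff)
  qed simp
qed

lemma hom_finprod_int_pow:
  assumes "comm_group G" "comm_group H" "f \<in> hom G H" "b \<in> I \<rightarrow> carrier G"
  shows "f (finprod G (\<lambda>i. b i [^]\<^bsub>G\<^esub> (c i :: int)) I) = finprod H (\<lambda>i. f (b i) [^]\<^bsub>H\<^esub> c i) I"
proof -
  interpret G: comm_group G by fact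
  interpret H: comm_group H by fact
  interpret group_hom G H f using assms by unfold_locales
  have "f (finprod G (\<lambda>i. b i [^]\<^bsub>G\<^esub> c i) I) = finprod H (\<lambda>i. f (b i [^]\<^bsub>G\<^esub> c i)) I"
    using assms by (intro hom_finprod_comm_group) auto
  also have "\<dots> = finprod H (\<lambda>i. f (b i) [^]\<^bsub>H\<^esub> c i) I"
    using assms(4) by (intro H.finprod_cong refl) (auto simp: hom_int_pow simp_implies_def Pi_iff)
  finally show ?thesis .
qed

lemma (in comm_group) finprod_int_pow_sum:
  assumes "finite I" "x \<in> carrier G"
  shows "finprod G (\<lambda>i. x [^] (c i :: int)) I = x [^] sum c I"
  using assms by (induction I rule: finite_induct) (auto simp: int_pow_mult)

text \<open>A relation on the subfamily extends by zero coefficients.\<close>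

lemma independent_family_subset:
  assumes "comm_group G" "independent_family G I b" "finite I" "J \<subseteq> I"
  shows "independent_family G J b"
proof -
  interpret comm_group G by fact
  show ?thesis
    unfolding independent_family_def
  proof (intro conjI allI impI)
    show "b \<in> J \<rightarrow> carrier G" using assms by (auto simp: independent_family_def)
    fix c :: "_ \<Rightarrow> int" assume *: "finprod G (\<lambda>i. b i [^]\<^bsub>G\<^esub> c i) J = \<one>\<^bsub>G\<^esub>"
    define d where "d = (\<lambda>i. if i \<in> J then c i else 0)"
    have "finprod G (\<lambda>i. b i [^]\<^bsub>G\<^esub> d i) I = finprod G (\<lambda>i. b i [^]\<^bsub>G\<^esub> c i) J"
      using assms by (intro finprod_mono_neutral_cong_right)
        (auto simp: d_def independent_family_def Pi_iff)
    then have "\<forall>i \<in> I. d i = 0"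
      using assms(2) * by (simp add: independent_family_def)
    then show "\<forall>i \<in> J. c i = 0" using assms(4) by (force simp: d_def)
  qed
qed

lemma independent_family_reindex:
  assumes "comm_group G" "bij_betw \<phi> J I" "independent_family G I b"
  shows "independent_family G J (b \<circ> \<phi>)"
proof -
  interpret comm_group G by fact
  have \<phi>: "inj_on \<phi> J" "\<phi> ` J = I" using assms(2) by (auto simp: bij_betw_def)
  have b: "b \<in> I \<rightarrow> carrier G" using assms(3) by (simp add: independent_family_def)
  show ?thesis
    unfolding independent_family_def
  proof (intro conjI allI impI)
    show "b \<circ> \<phi> \<in> J \<rightarrow> carrier G" using \<phi> b by auto
    fix c :: "_ \<Rightarrow> int" assume *: "finprod G (\<lambda>i. (b \<circ> \<phi>) i [^]\<^bsub>G\<^esub> c i) J = \<one>\<^bsub>G\<^esub>"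
    let ?c = "\<lambda>i. c (inv_into J \<phi> i)"
    have "finprod G (\<lambda>i. b i [^]\<^bsub>G\<^esub> ?c i) (\<phi> ` J) = finprod G (\<lambda>j. b (\<phi> j) [^]\<^bsub>G\<^esub> ?c (\<phi> j)) J"
      using \<phi> b by (intro finprod_reindex) auto
    also have "\<dots> = finprod G (\<lambda>i. (b \<circ> \<phi>) i [^]\<^bsub>G\<^esub> c i) J"
      using \<phi> b by (intro finprod_cong) (auto simp: simp_implies_def)
    finally have "finprod G (\<lambda>i. b i [^]\<^bsub>G\<^esub> ?c i) I = \<one>\<^bsub>G\<^esub>" using * \<phi>(2) by simp
    then have "\<forall>i \<in> I. ?c i = 0" using assms(3) by (auto simp: independent_family_def)
    then show "\<forall>j \<in> J. c j = 0" using \<phi> by force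
  qed
qed

lemma independent_family_cong:
  assumes "comm_group G" "independent_family G I b" "\<And>i. i \<in> I \<Longrightarrow> b i = d i"
  shows "independent_family G I d"
proof -
  interpret comm_group G by fact
  have b: "b \<in> I \<rightarrow> carrier G" using assms(2) by (simp add: independent_family_def)
  then have "finprod G (\<lambda>i. d i [^]\<^bsub>G\<^esub> (c i :: int)) I = finprod G (\<lambda>i. b i [^]\<^bsub>G\<^esub> c i) I" for c
    by (intro finprod_cong refl) (auto simp: assms(3)[symmetric] simp_implies_def Pi_iff)
  moreover have "d \<in> I \<rightarrow> carrier G"
    using b assms(3) by (metis Pi_iff)
  ultimately show ?thesis using assms(2) unfolding independent_family_def by simp
qed

lemma independent_family_preimage:
  assumes "comm_group G" "independent_family G I b" "b \<in> I \<rightarrow> f ` A"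
  obtains x where "x \<in> I \<rightarrow> A" "independent_family G I (\<lambda>i. f (x i))"
proof
  define x where "x = (\<lambda>i. SOME y. y \<in> A \<and> f y = b i)"
  have x: "x i \<in> A \<and> f (x i) = b i" if "i \<in> I" for i
    unfolding x_def by (rule someI_ex) (use that assms(3) in \<open>force simp: Pi_iff image_iff\<close>)
  then show "x \<in> I \<rightarrow> A" by blast
  show "independent_family G I (\<lambda>i. f (x i))"
    by (rule independent_family_cong[OF assms(1,2)]) (simp add: x)
qed

lemma rank_ge_0: "rank_ge G 0"
  unfolding rank_ge_def by (intro exI[of _ "{}"]) (simp add: independent_family_def)

text \<open>Every relation in \<open>G\<close> is mapped to a relation in \<open>H\<close> with the
  same coefficients.\<close>

lemma independent_family_lift:
  assumes "comm_group G" "comm_group H" "f \<in> hom G H" "b \<in> I \<rightarrow> carrier G"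
    and "independent_family H I (\<lambda>i. f (b i))"
  shows "independent_family G I b"
proof -
  have "f \<one>\<^bsub>G\<^esub> = \<one>\<^bsub>H\<^esub>"
    using hom_one[OF assms(3)] assms(1,2) by (simp add: comm_group.axioms)
  then have "finprod H (\<lambda>i. f (b i) [^]\<^bsub>H\<^esub> c i) I = \<one>\<^bsub>H\<^esub>"
    if "finprod G (\<lambda>i. b i [^]\<^bsub>G\<^esub> (c i :: int)) I = \<one>\<^bsub>G\<^esub>" for c
    using that hom_finprod_int_pow[OF assms(1-4), of c] by simp
  then show ?thesis using assms(4,5) unfolding independent_family_def by simp
qed

lemma independent_family_image:
  assumes "comm_group G" "comm_group H" "f \<in> hom G H" "inj_on f (carrier G)"
    and "independent_family G I b"
  shows "independent_family H I (\<lambda>i. f (b i))"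
proof -
  interpret G: comm_group G by fact
  interpret H: comm_group H by fact
  interpret group_hom G H f using assms by unfold_locales
  have b: "b \<in> I \<rightarrow> carrier G" using assms by (simp add: independent_family_def)
  then have 1: "finprod G (\<lambda>i. b i [^]\<^bsub>G\<^esub> (c i :: int)) I \<in> carrier G" for c
    by (intro G.finprod_closed) auto
  show ?thesis
    unfolding independent_family_def
  proof (intro conjI allI impI)
    fix c :: "_ \<Rightarrow> int" assume "(\<Otimes>\<^bsub>H\<^esub>i\<in>I. f (b i) [^]\<^bsub>H\<^esub> c i) = \<one>\<^bsub>H\<^esub>"
    then have "f (finprod G (\<lambda>i. b i [^]\<^bsub>G\<^esub> c i) I) = \<one>\<^bsub>H\<^esub>"
      using hom_finprod_int_pow[OF assms(1-3) b] by simp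
    then have "finprod G (\<lambda>i. b i [^]\<^bsub>G\<^esub> c i) I = \<one>\<^bsub>G\<^esub>"
      using inj_onD[OF assms(4) _ 1 G.one_closed] by simp
    then show "\<forall>i\<in>I. c i = 0" using assms(5) by (simp add: independent_family_def)
  qed (use b in \<open>auto simp: Pi_iff\<close>)
qed

lemma rank_ge_monic:
  assumes "comm_group G" "comm_group H" "f \<in> hom G H" "inj_on f (carrier G)" "rank_ge G n"
  shows "rank_ge H n"
proof -
  obtain I :: "nat set" and b where "finite I" "card I = n" "independent_family G I b"
    by (rule rank_geE[OF assms(5)])
  then show ?thesis
    using independent_family_image[OF assms(1-4)] unfolding rank_ge_def
    by (intro exI[of _ I] exI[of _ "\<lambda>i. f (b i)"]) auto
qed

lemma rank_ge_iso:
  assumes "comm_group G" "comm_group H" "G \<cong> H" "rank_ge G n"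
  shows "rank_ge H n"
  using assms rank_ge_monic[OF assms(1,2)] unfolding is_iso_def iso_def bij_betw_def by blast

lemma rank_ge_epi:
  assumes "comm_group G" "comm_group H" "f \<in> hom G H" "f ` carrier G = carrier H" "rank_ge H n"
  shows "rank_ge G n"
proof -
  obtain I :: "nat set" and b where b: "finite I" "card I = n" "independent_family H I b"
    by (rule rank_geE[OF assms(5)])
  then have "b \<in> I \<rightarrow> f ` carrier G"
    using assms(4) by (simp add: independent_family_def)
  then obtain a where a: "a \<in> I \<rightarrow> carrier G" "independent_family H I (\<lambda>i. f (a i))"
    using independent_family_preimage[OF assms(2) b(3)] by blast
  then have "independent_family G I a"
    by (rule independent_family_lift[OF assms(1-3)])
  then show ?thesis using b unfolding rank_ge_def by blast
qed

text \<open>Applying \<open>f\<close> to a relation kills the part from \<open>K\<close>, so the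
  coefficients of \<open>a\<close> vanish; injectivity of \<open>g\<close> then handles the rest.
  Independence is asked of the images of a given family, since \<open>f\<close> may fail to be
  onto.\<close>

lemma rank_ge_extension:
  assumes "comm_group K" "comm_group G" "comm_group H" "g \<in> hom K G" "f \<in> hom G H"
    and "inj_on g (carrier K)" "\<And>x. x \<in> carrier K \<Longrightarrow> f (g x) = \<one>\<^bsub>H\<^esub>"
    and K: "rank_ge K m"
    and a: "a \<in> I \<rightarrow> carrier G" "independent_family H I (\<lambda>i. f (a i))" "finite (I :: nat set)" "card I = n"
  shows "rank_ge G (n + m)"
proof -
  interpret G: comm_group G by fact
  interpret H: comm_group H by fact
  obtain J :: "nat set" and b where b: "finite J" "card J = m" "independent_family K J b"
    by (rule rank_geE[OF K])
  have bc: "b \<in> J \<rightarrow> carrier K" using b by (simp add: independent_family_def)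
  define d where "d = case_sum a (\<lambda>j. g (b j))"
  have gb: "(\<lambda>j. g (b j)) \<in> J \<rightarrow> carrier G"
    using bc assms(4) by (auto simp: hom_def Pi_iff)
  have "independent_family G (I <+> J) d"
    unfolding independent_family_def
  proof (intro conjI allI impI)
    show "d \<in> I <+> J \<rightarrow> carrier G" using a gb by (auto simp: d_def)
    fix c :: "nat + nat \<Rightarrow> int"
    have "finprod G (\<lambda>i. d i [^]\<^bsub>G\<^esub> c i) (I <+> J) =
        finprod G (\<lambda>i. d i [^]\<^bsub>G\<^esub> c i) (Inl ` I) \<otimes>\<^bsub>G\<^esub> finprod G (\<lambda>i. d i [^]\<^bsub>G\<^esub> c i) (Inr ` J)"
      unfolding Plus_def using a b gb
      by (intro G.finprod_Un_disjoint) (auto simp: d_def Pi_iff)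
    also have "finprod G (\<lambda>i. d i [^]\<^bsub>G\<^esub> c i) (Inl ` I) = finprod G (\<lambda>i. a i [^]\<^bsub>G\<^esub> c (Inl i)) I"
      using a by (subst G.finprod_reindex) (auto simp: d_def Pi_iff)
    also have "finprod G (\<lambda>i. d i [^]\<^bsub>G\<^esub> c i) (Inr ` J) = finprod G (\<lambda>i. g (b i) [^]\<^bsub>G\<^esub> c (Inr i)) J"
      using gb by (subst G.finprod_reindex) (auto simp: d_def Pi_iff)
    finally have *: "finprod G (\<lambda>i. d i [^]\<^bsub>G\<^esub> c i) (I <+> J) =
        finprod G (\<lambda>i. a i [^]\<^bsub>G\<^esub> c (Inl i)) I \<otimes>\<^bsub>G\<^esub> finprod G (\<lambda>i. g (b i) [^]\<^bsub>G\<^esub> c (Inr i)) J" .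
    have ca: "finprod G (\<lambda>i. a i [^]\<^bsub>G\<^esub> c (Inl i)) I \<in> carrier G"
      using a by (intro G.finprod_closed) auto
    have cb: "finprod G (\<lambda>i. g (b i) [^]\<^bsub>G\<^esub> c (Inr i)) J \<in> carrier G"
      using gb by (intro G.finprod_closed) auto
    have fb: "f (finprod G (\<lambda>i. g (b i) [^]\<^bsub>G\<^esub> c (Inr i)) J) = \<one>\<^bsub>H\<^esub>"
      using bc by (subst hom_finprod_int_pow[OF assms(2,3,5) gb])
         (auto intro!: H.finprod_one_eqI simp: assms(7) Pi_iff)
    assume 1: "finprod G (\<lambda>i. d i [^]\<^bsub>G\<^esub> c i) (I <+> J) = \<one>\<^bsub>G\<^esub>"
    then have "f (finprod G (\<lambda>i. a i [^]\<^bsub>G\<^esub> c (Inl i)) I \<otimes>\<^bsub>G\<^esub> finprod G (\<lambda>i. g (b i) [^]\<^bsub>G\<^esub> c (Inr i)) J) = \<one>\<^bsub>H\<^esub>"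
      using * assms(5) by (simp add: hom_one)
    then have "finprod H (\<lambda>i. f (a i) [^]\<^bsub>H\<^esub> c (Inl i)) I = \<one>\<^bsub>H\<^esub>"
      using hom_mult[OF assms(5) ca cb] hom_in_carrier[OF assms(5) ca] fb
      by (simp add: hom_finprod_int_pow[OF assms(2,3,5) a(1)])
    then have 2: "\<forall>i \<in> I. c (Inl i) = 0"
      using a(2)[unfolded independent_family_def, THEN conjunct2, rule_format, of "\<lambda>i. c (Inl i)"] by simp
    then have "finprod G (\<lambda>i. a i [^]\<^bsub>G\<^esub> c (Inl i)) I = \<one>\<^bsub>G\<^esub>"
      by (intro G.finprod_one_eqI) simp
    then have "finprod G (\<lambda>i. g (b i) [^]\<^bsub>G\<^esub> c (Inr i)) J = \<one>\<^bsub>G\<^esub>"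
      using * 1 cb by simp
    then have 3: "\<forall>j \<in> J. c (Inr j) = 0"
      using independent_family_image[OF assms(1,2,4,6) b(3),
          unfolded independent_family_def, THEN conjunct2, rule_format, of "\<lambda>i. c (Inr i)"] by simp
    show "\<forall>i \<in> I <+> J. c i = 0" using 2 3 by auto
  qed
  \<comment> \<open>The disjoint sum of the index sets is renumbered, as \<open>rank_ge\<close>
    wants natural numbers.\<close>
  moreover obtain \<phi> where \<phi>: "bij_betw \<phi> {..<n + m} (I <+> J)"
    using a(3,4) b(1,2) by (metis bij_betw_inv card_Plus ex_bij_betw_finite_nat finite_Plus lessThan_atLeast0)
  ultimately have "independent_family G {..<n + m} (d \<circ> \<phi>)"
    by (rule_tac independent_family_reindex[OF assms(2)])
  then show ?thesis unfolding rank_ge_def by (intro exI[of _ "{..<n+m}"]) auto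
qed

text \<open>A kernel of a map to the integers loses at most one from the rank: elimination without
  division against a member \<open>b k\<close> of nonzero value.\<close>

lemma rank_ge_kernel_integer:
  assumes "comm_group K" "comm_group G" "g \<in> hom K G" "f \<in> hom G integer_group"
    and ex: "g ` carrier K = kernel G integer_group f" and "rank_ge G (Suc n)"
  shows "rank_ge K n"
proof -
  interpret G: comm_group G by fact
  interpret gf: group_hom G integer_group f
    using assms(4) by (simp add: group_hom_def group_hom_axioms_def G.is_group)
  obtain I :: "nat set" and b where b: "finite I" "card I = Suc n" "independent_family G I b"
    by (rule rank_geE[OF assms(6)])
  have bc: "\<And>i. i \<in> I \<Longrightarrow> b i \<in> carrier G" using b(3) by (auto simp: independent_family_def)
  have "\<exists>J a. J \<subseteq> I \<and> card J = n \<and> a \<in> J \<rightarrow> kernel G integer_group f \<and> independent_family G J a"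
  proof (cases "\<exists>k \<in> I. f (b k) \<noteq> 0")
    case False
    \<comment> \<open>The whole family lies in the kernel; one index is dropped only to reach the
      count \<open>n\<close>.\<close>
    obtain J where "J \<subseteq> I" "card J = n"
      using b by (metis le_Suc_eq obtain_subset_with_card_n order_refl)
    then show ?thesis
      using False bc independent_family_subset[OF assms(2) b(3,1)]
      by (intro exI[of _ J] exI[of _ b]) (auto simp: kernel_def)
  next
    case True
    then obtain k where k: "k \<in> I" "f (b k) \<noteq> 0" by blast
    \<comment> \<open>Additively \<open>f (b k) * b i - f (b i) * b k\<close>, on which
      \<open>f\<close> vanishes.\<close>
    define a where "a = (\<lambda>i. b i [^]\<^bsub>G\<^esub> f (b k) \<otimes>\<^bsub>G\<^esub> b k [^]\<^bsub>G\<^esub> (- f (b i)))"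
    let ?J = "I - {k}"
    have a: "a \<in> ?J \<rightarrow> kernel G integer_group f"
      using bc k by (auto simp: a_def kernel_def gf.hom_int_pow)
    moreover have "independent_family G ?J a"
      unfolding independent_family_def
    proof (intro conjI allI impI)
      show "a \<in> ?J \<rightarrow> carrier G" using a by (auto simp: kernel_def)
      fix c :: "nat \<Rightarrow> int"
      \<comment> \<open>The coefficients that a combination of the \<open>a i\<close> has in terms
        of the \<open>b i\<close>; the contributions of \<open>b k\<close> are collected at
        \<open>k\<close>.\<close>
      define d where "d = (\<lambda>i. if i = k then - (\<Sum>i \<in> ?J. c i * f (b i)) else c i * f (b k))"
      have "finprod G (\<lambda>i. a i [^]\<^bsub>G\<^esub> c i) ?J =
          finprod G (\<lambda>i. b i [^]\<^bsub>G\<^esub> d i \<otimes>\<^bsub>G\<^esub> b k [^]\<^bsub>G\<^esub> (- (c i * f (b i)))) ?J"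
        using bc k by (intro G.finprod_cong refl)
          (auto simp: a_def d_def G.int_pow_distrib G.int_pow_pow algebra_simps simp_implies_def)
      also have "\<dots> = finprod G (\<lambda>i. b i [^]\<^bsub>G\<^esub> d i) ?J \<otimes>\<^bsub>G\<^esub> b k [^]\<^bsub>G\<^esub> (\<Sum>i \<in> ?J. - (c i * f (b i)))"
        using bc k b(1) by (subst G.finprod_multf) (auto simp: G.finprod_int_pow_sum)
      also have "\<dots> = b k [^]\<^bsub>G\<^esub> d k \<otimes>\<^bsub>G\<^esub> finprod G (\<lambda>i. b i [^]\<^bsub>G\<^esub> d i) ?J"
        using bc k by (subst G.m_comm) (auto simp: d_def sum_negf intro!: G.finprod_closed)
      also have "\<dots> = finprod G (\<lambda>i. b i [^]\<^bsub>G\<^esub> d i) (insert k ?J)"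
        using bc k b(1) by (subst G.finprod_insert) auto
      finally have "finprod G (\<lambda>i. a i [^]\<^bsub>G\<^esub> c i) ?J = finprod G (\<lambda>i. b i [^]\<^bsub>G\<^esub> d i) I"
        using k by (simp add: insert_absorb)
      moreover assume "finprod G (\<lambda>i. a i [^]\<^bsub>G\<^esub> c i) ?J = \<one>\<^bsub>G\<^esub>"
      ultimately have "\<forall>i \<in> I. d i = 0" using b(3) unfolding independent_family_def by metis
      then show "\<forall>i \<in> ?J. c i = 0" using k by (auto simp: d_def split: if_splits)
    qed
    ultimately show ?thesis using b k by (intro exI[of _ ?J] exI[of _ a]) auto
  qed
  then obtain J a where J: "J \<subseteq> I" "card J = n" "a \<in> J \<rightarrow> g ` carrier K" "independent_family G J a"
    using ex by auto
  obtain x where "x \<in> J \<rightarrow> carrier K" "independent_family G J (\<lambda>i. g (x i))"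
    by (rule independent_family_preimage[OF assms(2) J(4,3)])
  then have "independent_family K J x"
    by (rule independent_family_lift[OF assms(1-3)])
  then show ?thesis unfolding rank_ge_def using J b(1) finite_subset by blast
qed

section \<open>Finite rank and exact sequences\<close>

definition finite_rank :: "('a, 'b) monoid_scheme \<Rightarrow> bool" where
  "finite_rank G \<longleftrightarrow> (\<exists>n. \<not> rank_ge G n)"

text \<open>Induction from \<open>rank_ge_0\<close> has to break somewhere. An implication from
  \<open>rank_ge G n\<close> to \<open>rank_ge G (Suc n)\<close> for all \<open>n\<close> is thereby
  refuted.\<close>

lemma finite_rankE:
  assumes "finite_rank G"
  obtains n where "rank_ge G n" "\<not> rank_ge G (Suc n)"
  using assms rank_ge_0[of G] unfolding finite_rank_def by (metis nat_induct)

lemma independent_singleton_integer: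
  "k \<noteq> 0 \<Longrightarrow> independent_family integer_group {i} (\<lambda>_. k)"
proof -
  interpret comm_group integer_group by (rule abelian_integer_group)
  show "k \<noteq> 0 \<Longrightarrow> ?thesis"
    by (simp add: independent_family_def)
qed

lemma rank_ge_integer: "rank_ge integer_group (Suc 0)"
  unfolding rank_ge_def
  using independent_singleton_integer[of 1 "0 :: nat"] by (intro exI[of _ "{0}"]) auto

text \<open>If \<open>f\<close> is nonzero, the rank grows from \<open>A\<close> to \<open>B\<close>; otherwise \<open>e\<close> is injective and
  the rank drops from \<open>C\<close> to \<open>D\<close>.\<close>

lemma not_both_iso_of_exact_infinite_cyclic:
  assumes cg: "comm_group A" "comm_group B" "comm_group Z" "comm_group C" "comm_group D"
    and hom: "a \<in> hom A B" "f \<in> hom B Z" "e \<in> hom Z C" "h \<in> hom C D"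
    and inj: "inj_on a (carrier A)" and surj: "h ` carrier C = carrier D"
    and fa: "\<And>x. x \<in> carrier A \<Longrightarrow> f (a x) = \<one>\<^bsub>Z\<^esub>"
    and ex: "kernel Z C e = f ` carrier B"
    and he: "\<And>x. x \<in> carrier Z \<Longrightarrow> h (e x) = \<one>\<^bsub>D\<^esub>"
    and Z: "Z \<cong> integer_group" and fin: "finite_rank A" "finite_rank D"
    and iso: "B \<cong> A" "C \<cong> D"
  shows False
proof -
  obtain \<phi> where "\<phi> \<in> iso Z integer_group" using Z by (auto simp: is_iso_def)
  then have \<phi>: "\<phi> \<in> hom Z integer_group" "inj_on \<phi> (carrier Z)"
    by (auto simp: iso_def bij_betw_def)
  interpret Z: comm_group Z by fact
  interpret pz: group_hom Z integer_group \<phi>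
    using \<phi>(1) by (simp add: group_hom_def group_hom_axioms_def Z.is_group)
  interpret e: group_hom Z C e
    using hom cg by (simp add: group_hom_def group_hom_axioms_def comm_group.axioms)
  show False
  proof (cases "\<exists>x \<in> carrier B. f x \<noteq> \<one>\<^bsub>Z\<^esub>")
    case True
    then obtain x where x: "x \<in> carrier B" "f x \<noteq> \<one>\<^bsub>Z\<^esub>" by blast
    then have fx: "f x \<in> carrier Z" using hom by (auto simp: hom_def)
    then have "\<phi> (f x) \<noteq> 0"
      using x(2) \<phi>(2) pz.hom_one by (metis Z.one_closed inj_onD one_integer_group)
    then have "independent_family integer_group {0::nat} (\<lambda>_. \<phi> (f x))"
      by (rule independent_singleton_integer)
    then have "independent_family Z {0::nat} (\<lambda>_. f x)"
      using fx by (intro independent_family_lift[OF cg(3) abelian_integer_group \<phi>(1)]) auto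
    \<comment> \<open>The embedded copy of \<open>A\<close> dies under \<open>f\<close> while
      \<open>x\<close> has an independent image, so \<open>B\<close> gains one over
      \<open>A\<close>.\<close>
    then have "rank_ge B (Suc 0 + n)" if "rank_ge A n" for n
      using rank_ge_extension[OF cg(1-3) hom(1,2) inj fa that, of "\<lambda>_. x" "{0}" "Suc 0"] x(1) by simp
    then have "rank_ge A (Suc n)" if "rank_ge A n" for n
      using that rank_ge_iso[OF cg(2,1) iso(1)] by simp
    then show False using fin(1) by (metis finite_rankE)
  next
    case False
    have "\<one>\<^bsub>B\<^esub> \<in> carrier B" using cg(2) by (simp add: comm_group.axioms group.is_monoid)
    then have "kernel Z C e = {\<one>\<^bsub>Z\<^esub>}" using False ex by auto
    then have injZ: "inj_on e (carrier Z)" using e.trivial_ker_imp_inj by blast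
    have Z1: "rank_ge Z (Suc 0)"
      by (rule rank_ge_iso[OF abelian_integer_group cg(3) Z.iso_sym[OF Z] rank_ge_integer])
    \<comment> \<open>Now the infinite cyclic group \<open>Z\<close> embeds into \<open>C\<close>
      and dies under \<open>h\<close>; together with lifts of an independent family of
      \<open>D\<close> it gives \<open>C\<close> one more than \<open>D\<close>.\<close>
    have "rank_ge C (n + Suc 0)" if D: "rank_ge D n" for n
    proof -
      obtain I :: "nat set" and b where b: "finite I" "card I = n" "independent_family D I b"
        by (rule rank_geE[OF D])
      then have "b \<in> I \<rightarrow> h ` carrier C"
        unfolding surj by (simp add: independent_family_def)
      then obtain x where x: "x \<in> I \<rightarrow> carrier C" "independent_family D I (\<lambda>i. h (x i))"
        by (rule independent_family_preimage[OF cg(5) b(3)])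
      then show ?thesis
        using rank_ge_extension[OF cg(3-5) hom(3,4) injZ he Z1 x b(1,2)] by simp
    qed
    then have "rank_ge D (Suc n)" if "rank_ge D n" for n
      using that rank_ge_iso[OF cg(4,5) iso(2)] by simp
    then show False using fin(2) by (metis finite_rankE)
  qed
qed

lemma finite_rank_epi:
  assumes "comm_group G" "comm_group H" "f \<in> hom G H" "f ` carrier G = carrier H" "finite_rank G"
  shows "finite_rank H"
  using assms rank_ge_epi unfolding finite_rank_def by blast

text \<open>By exactness at \<open>G\<close>, an independent family in \<open>G\<close> yields one
  in \<open>K\<close> with at most one member fewer.\<close>

lemma finite_rank_kernel_integer:
  assumes "comm_group K" "comm_group G" "comm_group Z" "g \<in> hom K G" "f \<in> hom G Z"
    and ex: "g ` carrier K = kernel G Z f" and Z: "Z \<cong> integer_group" and "finite_rank K"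
  shows "finite_rank G"
proof -
  obtain \<phi> where "\<phi> \<in> iso Z integer_group" using Z by (auto simp: is_iso_def)
  then have \<phi>: "\<phi> \<in> hom Z integer_group" "inj_on \<phi> (carrier Z)"
    by (auto simp: iso_def bij_betw_def)
  interpret pz: group_hom Z integer_group \<phi>
    using \<phi>(1) assms(3) by (simp add: group_hom_def group_hom_axioms_def comm_group.axioms)
  have "\<phi> (f x) = 0 \<longleftrightarrow> f x = \<one>\<^bsub>Z\<^esub>" if "x \<in> carrier G" for x
    using that hom_in_carrier[OF assms(5)] \<phi>(2) pz.hom_one
    by (metis inj_onD one_integer_group pz.G.one_closed)
  then have "g ` carrier K = kernel G integer_group (\<phi> \<circ> f)"
    unfolding ex kernel_def by auto
  then have "rank_ge G (Suc n) \<Longrightarrow> rank_ge K n" for n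
    using rank_ge_kernel_integer[OF assms(1,2,4) hom_compose[OF assms(5) \<phi>(1)]] by blast
  then show ?thesis using assms(8) unfolding finite_rank_def by blast
qed

section \<open>Attaching a simplex\<close>

text \<open>In the exact sequence of the triple \<open>T\<close>, \<open>S\<close>,
  \<open>X\<close>, the two neighbours of the map are groups of the pair \<open>(S, T)\<close> and
  vanish. This serves to fatten a subspace before excision.\<close>

lemma relative_homology_iso_of_trivial_bottom:
  assumes "T \<subseteq> S" "trivial_group (relative_homology_group p (subtopology X S) T)"
    "trivial_group (relative_homology_group (p - 1) (subtopology X S) T)"
  shows "relative_homology_group p X T \<cong> relative_homology_group p X S"
proof -
  have "hom_induced p X T X S id \<in> iso (relative_homology_group p X T) (relative_homology_group p X S)"
  proof (rule very_short_exact_sequence)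
    show "exact_seq ([relative_homology_group (p - 1) (subtopology X S) T, relative_homology_group p X S,
        relative_homology_group p X T, relative_homology_group p (subtopology X S) T],
       [hom_relboundary p X S T, hom_induced p X T X S id, hom_induced p (subtopology X S) T X T id])"
      using homology_exactness_triple_1[OF assms(1), of p X] homology_exactness_triple_3[OF assms(1), of p X]
      by (metis exact_seq_cons_iff)
  qed (use assms in auto)
  then show ?thesis by (rule is_isoI)
qed

text \<open>In the same sequence the groups of \<open>(X, T)\<close> vanish, so the connecting map
  is bijective. It provides the descent in degree.\<close>

lemma relative_homology_iso_of_trivial_middle:
  assumes "T \<subseteq> S" "trivial_group (relative_homology_group p X T)"
    "trivial_group (relative_homology_group (p - 1) X T)"
  shows "relative_homology_group p X S \<cong> relative_homology_group (p - 1) (subtopology X S) T"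
proof -
  have "hom_relboundary p X S T \<in>
      iso (relative_homology_group p X S) (relative_homology_group (p - 1) (subtopology X S) T)"
  proof (rule very_short_exact_sequence)
    show "exact_seq ([relative_homology_group (p - 1) X T, relative_homology_group (p - 1) (subtopology X S) T,
        relative_homology_group p X S, relative_homology_group p X T],
       [hom_induced (p - 1) (subtopology X S) T X T id, hom_relboundary p X S T, hom_induced p X T X S id])"
      using homology_exactness_triple_1[OF assms(1), of p X] homology_exactness_triple_2[OF assms(1), of p X]
      by (metis exact_seq_cons_iff)
  qed (use assms in auto)
  then show ?thesis by (rule is_isoI)
qed

lemma subtopology_top_of_set: "S \<subseteq> T \<Longrightarrow> subtopology (top_of_set T) S = top_of_set S"
  by (simp add: subtopology_subtopology Int_absorb1)

lemma real_set_mono: "K \<subseteq> L \<Longrightarrow> real_set K \<subseteq> real_set L"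
  by (auto simp: real_set_def)

lemma real_set_insert: "real_set (insert \<sigma> X) = real_set {\<sigma>} \<union> real_set X"
  by (auto simp: real_set_def)

text \<open>Attaching the empty face is kept out: it would mean leaving the void complex, whose
  realization is a convention.\<close>

locale simplex_attachment =
  fixes X :: "'a::finite set set" and \<sigma> :: "'a set"
  assumes face_closed_X: "face_closed X" and boundary: "\<And>\<tau>. \<tau> \<subset> \<sigma> \<Longrightarrow> \<tau> \<in> X"
    and new: "\<sigma> \<notin> X" and nonempty: "\<sigma> \<noteq> {}"
begin

text \<open>\<open>1 / card \<sigma>\<close> is the greatest value of
  \<open>min_coord \<sigma>\<close>, taken at the barycentre of \<open>\<sigma>\<close> only, so
  exactly this point is missing.\<close>

definition punctured :: "('a \<Rightarrow> real) set" where
  "punctured = {x \<in> real_set (insert \<sigma> X). min_coord \<sigma> x < 1 / card \<sigma>}"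

text \<open>No face of \<open>X\<close> contains \<open>\<sigma>\<close>, since \<open>X\<close> is
  face-closed and lacks \<open>\<sigma>\<close>. Thus \<open>X\<close> is the zero set of a
  continuous function.\<close>

lemma real_set_iff_min_coord_0:
  assumes "x \<in> real_set (insert \<sigma> X)"
  shows "x \<in> real_set X \<longleftrightarrow> min_coord \<sigma> x = 0"
  using assms face_closedD[OF face_closed_X, of "{v. x v \<noteq> 0}" \<sigma>] new nonempty
  by (subst min_coord_eq_0_iff) (auto simp: real_set_def)

lemma card_pos: "card \<sigma> > 0"
  using nonempty by (simp add: card_gt_0_iff)

lemma real_set_subset_punctured: "real_set X \<subseteq> punctured"
proof
  fix x assume x: "x \<in> real_set X"
  then have K: "x \<in> real_set (insert \<sigma> X)" by (subst real_set_insert) simp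
  then have "min_coord \<sigma> x = 0" using real_set_iff_min_coord_0[OF K] x by simp
  with K show "x \<in> punctured" using card_pos by (simp add: punctured_def)
qed

text \<open>\<open>r\<close> is the radial projection of the open simplex, minus its barycentre, to the boundary.\<close>

lemma trivial_homology_punctured:
  "trivial_group (relative_homology_group p (top_of_set punctured) (real_set X))"
proof -
  let ?m = "min_coord \<sigma>" and ?P = "punctured"
  \<comment> \<open>Moving away from the barycentre lowers all coordinates in
    \<open>\<sigma>\<close> equally until one vanishes; the denominator is the mass left, positive
    because the barycentre is excluded.\<close>
  define r where "r = (\<lambda>x u. (x u - ?m x * of_bool (u \<in> \<sigma>)) / (1 - card \<sigma> * ?m x))"
  have den: "1 - card \<sigma> * ?m x > 0" if "x \<in> ?P" for x
    using that card_pos by (simp add: punctured_def field_simps)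
  have inX: "x \<in> real_set X \<longleftrightarrow> ?m x = 0" if "x \<in> ?P" for x
    using real_set_iff_min_coord_0 that by (auto simp: punctured_def)
  have r0: "r x = x" if "?m x = 0" for x
    using that by (auto simp: r_def)
  \<comment> \<open>Points of \<open>punctured\<close> outside \<open>X\<close> lie in the open
    simplex \<open>\<sigma>\<close>.\<close>
  have off: "x u = 0" if "x \<in> ?P" "?m x \<noteq> 0" "u \<notin> \<sigma>" for x u
  proof -
    have "{u. x u \<noteq> 0} \<in> insert \<sigma> X" "{u. x u \<noteq> 0} \<notin> X"
      using that(1,2) inX[OF that(1)] unfolding punctured_def real_set_def mem_Collect_eq by blast+
    then have "{u. x u \<noteq> 0} = \<sigma>" by blast
    then show ?thesis using that(3) by blast
  qed
  have sumr: "sum (r x) UNIV = 1" if "x \<in> ?P" for x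
  proof -
    have "sum (r x) UNIV = (\<Sum>u\<in>UNIV. x u - ?m x * of_bool (u \<in> \<sigma>)) / (1 - card \<sigma> * ?m x)"
      by (simp add: r_def sum_divide_distrib)
    also have "(\<Sum>u\<in>UNIV. x u - ?m x * of_bool (u \<in> \<sigma>)) = sum x UNIV - ?m x * (\<Sum>u\<in>UNIV. of_bool (u \<in> \<sigma>))"
      by (simp only: sum_subtractf sum_distrib_left)
    also have "\<dots> = 1 - card \<sigma> * ?m x"
      using that by (simp add: punctured_def real_set_def)
    finally show ?thesis using den[OF that] by simp
  qed
  have rnn: "0 \<le> r x u" if "x \<in> ?P" for x u
    using that min_coord_le[of u \<sigma> x] den[OF that] by (auto simp: r_def punctured_def real_set_def)
  have rsupp: "\<exists>w \<in> \<sigma>. r x w = 0 \<and> ?m x = x w" for x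
    using min_coord_attained[OF nonempty, of x] by (force simp: r_def)
  have roff: "r x u = 0" if "x \<in> ?P" "?m x \<noteq> 0" "u \<notin> \<sigma>" for x u
    using off[OF that] that(3) by (simp add: r_def)
  show ?thesis
  proof (rule straight_line_retraction(2)[where r = r])
    show "real_set X \<subseteq> ?P" by (rule real_set_subset_punctured)
    have "continuous_on ?P (\<lambda>x. r x u)" for u
      unfolding r_def
      by (intro continuous_intros continuous_on_min_coord nonempty
        continuous_on_subset[OF continuous_on_product_coordinates]) (auto dest: den)
    then show "continuous_on ?P r"
      by (intro continuous_on_coordinatewise_then_product)
    show "r x = x" if "x \<in> real_set X" for x
      using that real_set_subset_punctured inX r0 by blast
    show "r \<in> ?P \<rightarrow> real_set X"
    proof
      fix x assume x: "x \<in> ?P"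
      show "r x \<in> real_set X"
      proof (cases "?m x = 0")
        case True
        then show ?thesis using x inX r0 by simp
      next
        case False
        have "{u. r x u \<noteq> 0} \<subset> \<sigma>"
          using roff[OF x False] rsupp[of x] by blast
        then show ?thesis using rnn[OF x] sumr[OF x] boundary by (simp add: real_set_def)
      qed
    qed
    fix x and t :: real assume x: "x \<in> ?P" and t: "0 \<le> t" "t \<le> 1"
    let ?y = "\<lambda>u. (1 - t) * r x u + t * x u"
    show "?y \<in> ?P"
    proof (cases "?m x = 0")
      case True
      then have "?y = x" by (simp add: r0 algebra_simps)
      then show ?thesis using x by simp
    next
      case False
      have "(1 - t) * r x u + t * x u = 0" if "u \<notin> \<sigma>" for u
        using off[OF x False that] roff[OF x False that] by simp
      then have "{u. ?y u \<noteq> 0} \<subseteq> \<sigma>" by blast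
      then have y1: "{u. ?y u \<noteq> 0} \<in> insert \<sigma> X" using boundary by blast
      have y2: "sum ?y UNIV = 1"
      proof -
        have "sum ?y UNIV = (1 - t) * sum (r x) UNIV + t * sum x UNIV"
          by (simp only: sum.distrib sum_distrib_left)
        also have "sum x UNIV = 1" using x by (simp add: punctured_def real_set_def)
        finally show ?thesis using sumr[OF x] by simp
      qed
      have y3: "0 \<le> ?y u" for u
        using rnn[OF x] x t by (simp add: punctured_def real_set_def)
      \<comment> \<open>At \<open>w\<close> the segment has the coordinate \<open>t * x w\<close>,
        which bounds the minimum along it; hence the segment avoids the barycentre.\<close>
      obtain w where w: "w \<in> \<sigma>" "r x w = 0" "?m x = x w" using rsupp by blast
      have "min_coord \<sigma> ?y \<le> t * ?m x"
        using min_coord_le[OF w(1), of ?y] w by simp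
      also have "t * ?m x \<le> 1 * ?m x"
        using t x min_coord_nonneg[OF nonempty, of x]
        by (intro mult_right_mono) (auto simp: punctured_def real_set_def)
      also have "\<dots> < 1 / card \<sigma>" using x by (simp add: punctured_def)
      finally have "min_coord \<sigma> ?y < 1 / card \<sigma>" .
      then show ?thesis using y1 y2 y3 by (simp add: punctured_def real_set_def)
    qed
  qed
qed

text \<open>Excision of \<open>X\<close> after fattening it to the complement of the barycentre.\<close>

lemma relative_homology_eq_open_simplex:
  "relative_homology_group p (top_of_set (real_set (insert \<sigma> X))) (real_set X) \<cong>
   relative_homology_group p (top_of_set (real_set {\<sigma>})) {x \<in> real_set {\<sigma>}. min_coord \<sigma> x < 1 / card \<sigma>}"
proof -
  let ?K = "real_set (insert \<sigma> X)" and ?m = "min_coord \<sigma>"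
  have PK: "punctured \<subseteq> ?K" by (auto simp: punctured_def)
  have "relative_homology_group p (top_of_set ?K) (real_set X) \<cong> relative_homology_group p (top_of_set ?K) punctured"
    using real_set_subset_punctured trivial_homology_punctured
    by (intro relative_homology_iso_of_trivial_bottom) (auto simp: subtopology_top_of_set PK)
  also have "\<dots> \<cong> relative_homology_group p (top_of_set (?K - real_set X)) (punctured - real_set X)"
  proof -
    \<comment> \<open>Excision needs the closure of \<open>X\<close> inside the interior of
      \<open>punctured\<close>. Both sets are preimages under \<open>min_coord\<close>, of a closed
      and of an open set.\<close>
    have "closedin (top_of_set ?K) (?K \<inter> ?m -` {0})"
      by (intro continuous_closedin_preimage continuous_on_min_coord nonempty) auto
    moreover have "?K \<inter> ?m -` {0} = real_set X"
    proof -
      have "real_set X \<subseteq> ?K" by (rule real_set_mono) blast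
      then show ?thesis using real_set_iff_min_coord_0 by (simp add: set_eq_iff subset_iff) blast
    qed
    ultimately have cl: "top_of_set ?K closure_of real_set X = real_set X"
      by (simp add: closure_of_closedin)
    have "openin (top_of_set ?K) (?K \<inter> ?m -` {..<1 / card \<sigma>})"
      by (intro continuous_openin_preimage_gen continuous_on_min_coord nonempty) auto
    moreover have "?K \<inter> ?m -` {..<1 / card \<sigma>} = punctured"
      by (auto simp: punctured_def)
    ultimately have "top_of_set ?K interior_of punctured = punctured"
      by (simp add: interior_of_openin)
    then have "hom_induced p (subtopology (top_of_set ?K) (?K - real_set X)) (punctured - real_set X)
        (subtopology (top_of_set ?K) ?K) punctured id \<in>
      iso (relative_homology_group p (subtopology (top_of_set ?K) (?K - real_set X)) (punctured - real_set X))
        (relative_homology_group p (subtopology (top_of_set ?K) ?K) punctured)"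
      using cl real_set_subset_punctured PK by (intro homology_excision_axiom) auto
    then have "relative_homology_group p (top_of_set (?K - real_set X)) (punctured - real_set X) \<cong>
        relative_homology_group p (top_of_set ?K) punctured"
      by (intro is_isoI) (simp add: subtopology_top_of_set)
    then show ?thesis by (rule group.iso_sym[rotated]) simp
  qed
  \<comment> \<open>The remaining pair no longer mentions \<open>X\<close>, so the relative groups
    are the same for every complex to which \<open>\<sigma>\<close> is attached.\<close>
  also have "?K - real_set X = real_set {\<sigma>}"
    using new by (auto simp: real_set_def)
  also have "punctured - real_set X = {x \<in> real_set {\<sigma>}. min_coord \<sigma> x < 1 / card \<sigma>}"
    using new by (auto simp: real_set_def punctured_def)
  finally show ?thesis .
qed

end

section \<open>The homology of a simplex relative to its boundary\<close>

definition infinite_cyclic_in_degree :: "int \<Rightarrow> int \<Rightarrow> ('a, 'b) monoid_scheme \<Rightarrow> bool" where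
  "infinite_cyclic_in_degree d p G \<longleftrightarrow> (if p = d then G \<cong> integer_group else trivial_group G)"

lemma infinite_cyclic_in_degree_iso:
  assumes "infinite_cyclic_in_degree d p H" "G \<cong> H" "group G" "group H"
  shows "infinite_cyclic_in_degree d p G"
  using assms isomorphic_group_triviality iso_trans unfolding infinite_cyclic_in_degree_def by metis

text \<open>Start of the induction on dimension: \<open>{{}}\<close> is realized by the empty set,
  so the relative groups are those of a point.\<close>

lemma infinite_cyclic_in_degree_point:
  fixes v :: "'a::finite"
  shows "infinite_cyclic_in_degree 0 p (relative_homology_group p (top_of_set (real_set {{}, {v}})) (real_set {{}}))"
proof -
  have "real_set {{} :: 'a set} = {}" by (auto simp: real_set_def fun_eq_iff)
  moreover have "real_set {{}, {v}} = {\<lambda>u. if u = v then 1 else 0}"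
    using realization_Pow_vertex[of v] by (metis insert_not_empty realization_eq topspace_euclidean_subtopology)
  ultimately show ?thesis
    using homology_dimension_axiom[of "top_of_set {\<lambda>u. if u = v then 1 else 0 :: real}"]
      homology_coefficients[of "top_of_set {\<lambda>u. if u = v then 1 else 0 :: real}"]
    by (simp add: infinite_cyclic_in_degree_def)
qed

text \<open>The pattern is that of a ball relative to its boundary sphere. Excision trades
  \<open>X\<close> for the boundary of \<open>\<sigma>\<close>; in the triple of a horn, the
  boundary and the full simplex, the simplex is acyclic relative to the horn, and the boundary is
  the horn with the smaller simplex \<open>\<tau>\<close> attached.\<close>

lemma relative_homology_attachment:
  fixes X :: "'a::finite set set"
  assumes "simplex_attachment X \<sigma>"
  shows "infinite_cyclic_in_degree (int (card \<sigma>) - 1) p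
     (relative_homology_group p (top_of_set (real_set (insert \<sigma> X))) (real_set X))"
  using assms
proof (induction "card \<sigma>" arbitrary: X \<sigma> p)
  case 0
  then interpret simplex_attachment X \<sigma> by simp
  show ?case using 0 card_pos by simp
next
  case (Suc n)
  then interpret simplex_attachment X \<sigma> by simp
  obtain v where v: "v \<in> \<sigma>" using nonempty by blast
  define \<tau> where "\<tau> = \<sigma> - {v}"
  interpret bd: simplex_attachment "Pow \<sigma> - {\<sigma>}" \<sigma>
    by unfold_locales (use nonempty in \<open>auto simp: face_closed_def\<close>)
  \<comment> \<open>Two uses of excision, both ending at the pair formed from the open
    simplex.\<close>
  have same: "relative_homology_group p (top_of_set (real_set (insert \<sigma> X))) (real_set X) \<cong>
      relative_homology_group p (top_of_set (real_set (insert \<sigma> Y))) (real_set Y)"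
    if "simplex_attachment Y \<sigma>" for Y
    using iso_trans[OF relative_homology_eq_open_simplex
        group.iso_sym[OF _ simplex_attachment.relative_homology_eq_open_simplex[OF that]]]
    by simp
  show ?case
  proof (cases "\<tau> = {}")
    case True
    then have \<sigma>: "\<sigma> = {v}" using v by (auto simp: \<tau>_def)
    have pt: "simplex_attachment {{}} \<sigma>"
      by unfold_locales (auto simp: \<sigma> face_closed_def)
    then show ?thesis
      using infinite_cyclic_in_degree_iso[OF _ same[OF pt], of 0] infinite_cyclic_in_degree_point[of p v]
      by (simp add: \<sigma> insert_commute)
  next
    case False
    \<comment> \<open>The horn: the boundary of \<open>\<sigma>\<close> without the face
      \<open>\<tau>\<close> opposite to \<open>v\<close>.\<close>
    let ?H = "Pow \<sigma> - {\<tau>, \<sigma>}"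
    have \<sigma>: "insert v \<tau> = \<sigma>" "v \<notin> \<tau>" using v by (auto simp: \<tau>_def)
    interpret face: simplex_attachment ?H \<tau>
    proof
      show "face_closed ?H"
        unfolding face_closed_def
      proof (intro ballI subsetI)
        fix A B assume "A \<in> ?H" "B \<in> Pow A"
        then show "B \<in> ?H" using \<sigma> by (auto simp: subset_insert_iff)
      qed
    qed (use False \<sigma> in auto)
    \<comment> \<open>\<open>\<tau>\<close> is a free face of the full simplex, so the latter
      collapses onto the horn.\<close>
    have triv: "trivial_group (relative_homology_group q (top_of_set (real_set (Pow \<sigma>))) (real_set ?H))" for q
    proof -
      have "trivial_group (relative_homology_group q (top_of_set (real_set (Pow \<sigma>))) (real_set (Pow \<sigma> - {\<tau>, insert v \<tau>})))"
        by (rule elementary_collapse(2)) (use False \<sigma> in \<open>auto simp: face_closed_def\<close>)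
      then show ?thesis using \<sigma> by simp
    qed
    have "relative_homology_group p (top_of_set (real_set (insert \<sigma> X))) (real_set X) \<cong>
        relative_homology_group p (top_of_set (real_set (Pow \<sigma>))) (real_set (Pow \<sigma> - {\<sigma>}))"
      using same[OF bd.simplex_attachment_axioms] by (simp add: insert_absorb)
    also have "\<dots> \<cong> relative_homology_group (p - 1)
        (subtopology (top_of_set (real_set (Pow \<sigma>))) (real_set (Pow \<sigma> - {\<sigma>}))) (real_set ?H)"
      by (intro relative_homology_iso_of_trivial_middle triv real_set_mono) auto
    also have "subtopology (top_of_set (real_set (Pow \<sigma>))) (real_set (Pow \<sigma> - {\<sigma>})) =
        top_of_set (real_set (insert \<tau> ?H))"
    proof -
      have "insert \<tau> ?H = Pow \<sigma> - {\<sigma>}" using \<sigma> by auto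
      then show ?thesis by (simp add: subtopology_top_of_set real_set_mono)
    qed
    finally have iso: "relative_homology_group p (top_of_set (real_set (insert \<sigma> X))) (real_set X) \<cong>
        relative_homology_group (p - 1) (top_of_set (real_set (insert \<tau> ?H))) (real_set ?H)" .
    have n: "n = card \<tau>" using Suc(2) v by (simp add: \<tau>_def)
    have "infinite_cyclic_in_degree (int (card \<tau>) - 1) (p - 1)
        (relative_homology_group (p - 1) (top_of_set (real_set (insert \<tau> ?H))) (real_set ?H))"
      by (rule Suc(1)[OF n face.simplex_attachment_axioms])
    then have "infinite_cyclic_in_degree (int (card \<sigma>) - 1) p
        (relative_homology_group (p - 1) (top_of_set (real_set (insert \<tau> ?H))) (real_set ?H))"
      using Suc(2) n by (auto simp: infinite_cyclic_in_degree_def)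
    then show ?thesis using infinite_cyclic_in_degree_iso[OF _ iso] by simp
  qed
qed

section \<open>Homology before and after an attachment\<close>

lemma face_closed_remove_maximal:
  assumes "face_closed K" "\<And>A. A \<in> K \<Longrightarrow> \<sigma> \<subseteq> A \<Longrightarrow> A = \<sigma>"
  shows "face_closed (K - {\<sigma>})"
  using assms unfolding face_closed_def by blast

lemma real_set_trivial: "K \<subseteq> {{}} \<Longrightarrow> real_set K = {}"
  by (auto simp: real_set_def fun_eq_iff)

lemma finite_rank_trivial:
  assumes "comm_group G" "trivial_group G"
  shows "finite_rank G"
proof -
  interpret comm_group G by fact
  have "\<not> rank_ge G (Suc 0)"
  proof
    assume "rank_ge G (Suc 0)"
    then obtain I :: "nat set" and b where b: "finite I" "card I = Suc 0" "independent_family G I b"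
      by (rule rank_geE)
    have "finprod G (\<lambda>i. b i [^]\<^bsub>G\<^esub> (1 :: int)) I \<in> carrier G"
      using b(3) by (intro finprod_closed) (auto simp: independent_family_def Pi_iff)
    then have "finprod G (\<lambda>i. b i [^]\<^bsub>G\<^esub> (1 :: int)) I = \<one>\<^bsub>G\<^esub>"
      using assms(2) by (auto simp: trivial_group_def)
    then have "\<forall>i \<in> I. (1 :: int) = 0"
      using b(3)[unfolded independent_family_def, THEN conjunct2, rule_format, of "\<lambda>_. 1"] by blast
    then show False using b(2) by auto
  qed
  then show ?thesis unfolding finite_rank_def by blast
qed

lemma simplex_attachment_facet:
  fixes K :: "'a::finite set set"
  assumes "face_closed K" "\<sigma> \<in> K" "\<sigma> \<noteq> {}" "\<And>A. A \<in> K \<Longrightarrow> \<sigma> \<subseteq> A \<Longrightarrow> A = \<sigma>"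
  shows "simplex_attachment (K - {\<sigma>}) \<sigma>"
proof
  show "face_closed (K - {\<sigma>})" by (rule face_closed_remove_maximal[OF assms(1,4)])
  show "\<tau> \<in> K - {\<sigma>}" if "\<tau> \<subset> \<sigma>" for \<tau>
    using that face_closedD[OF assms(1,2)] by blast
qed (use assms in auto)

context simplex_attachment
begin

text \<open>This and the next two facts are the exact sequence of the pair at its three positions,
  with subspaces rewritten as \<open>top_of_set\<close>.\<close>

lemma inclusion_exact:
  "hom_induced p (top_of_set (real_set X)) {} (top_of_set (real_set (insert \<sigma> X))) {} id `
     carrier (homology_group p (top_of_set (real_set X))) =
   kernel (homology_group p (top_of_set (real_set (insert \<sigma> X))))
     (relative_homology_group p (top_of_set (real_set (insert \<sigma> X))) (real_set X))
     (hom_induced p (top_of_set (real_set (insert \<sigma> X))) {} (top_of_set (real_set (insert \<sigma> X))) (real_set X) id)"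
  using homology_exactness_axiom_3[of p "top_of_set (real_set (insert \<sigma> X))" "real_set X"]
  by (simp add: subtopology_top_of_set real_set_mono subset_insertI)

lemma boundary_exact_left:
  "hom_induced p (top_of_set (real_set (insert \<sigma> X))) {} (top_of_set (real_set (insert \<sigma> X))) (real_set X) id `
     carrier (homology_group p (top_of_set (real_set (insert \<sigma> X)))) =
   kernel (relative_homology_group p (top_of_set (real_set (insert \<sigma> X))) (real_set X))
     (homology_group (p - 1) (top_of_set (real_set X)))
     (hom_boundary p (top_of_set (real_set (insert \<sigma> X))) (real_set X))"
  using homology_exactness_axiom_1[of p "top_of_set (real_set (insert \<sigma> X))" "real_set X"]
  by (simp add: subtopology_top_of_set real_set_mono subset_insertI)

lemma boundary_exact_right:
  "hom_boundary p (top_of_set (real_set (insert \<sigma> X))) (real_set X) `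
     carrier (relative_homology_group p (top_of_set (real_set (insert \<sigma> X))) (real_set X)) =
   kernel (homology_group (p - 1) (top_of_set (real_set X)))
     (homology_group (p - 1) (top_of_set (real_set (insert \<sigma> X))))
     (hom_induced (p - 1) (top_of_set (real_set X)) {} (top_of_set (real_set (insert \<sigma> X))) {} id)"
  using homology_exactness_axiom_2[of p "top_of_set (real_set (insert \<sigma> X))" "real_set X"]
  by (simp add: subtopology_top_of_set real_set_mono subset_insertI)

lemma boundary_hom:
  "hom_boundary p (top_of_set (real_set (insert \<sigma> X))) (real_set X) \<in>
    hom (relative_homology_group p (top_of_set (real_set (insert \<sigma> X))) (real_set X))
      (homology_group (p - 1) (top_of_set (real_set X)))"
  using hom_boundary_hom[of p "top_of_set (real_set (insert \<sigma> X))" "real_set X"]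
  by (simp add: subtopology_top_of_set real_set_mono subset_insertI)

text \<open>In the degree of \<open>\<sigma>\<close> the relative group is infinite cyclic, so at
  most one is added to the rank; in every other degree it vanishes and the inclusion is
  onto.\<close>

lemma finite_rank_attachment:
  assumes "finite_rank (homology_group p (top_of_set (real_set X)))"
  shows "finite_rank (homology_group p (top_of_set (real_set (insert \<sigma> X))))"
proof (cases "p = int (card \<sigma>) - 1")
  case True
  then have Z: "relative_homology_group p (top_of_set (real_set (insert \<sigma> X))) (real_set X) \<cong> integer_group"
    using relative_homology_attachment[OF simplex_attachment_axioms, of p] by (simp add: infinite_cyclic_in_degree_def)
  show ?thesis
    by (rule finite_rank_kernel_integer[OF abelian_homology_group abelian_homology_group
          abelian_relative_homology_group hom_induced_hom hom_induced_hom inclusion_exact Z assms])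
next
  case False
  then have triv: "trivial_group (relative_homology_group p (top_of_set (real_set (insert \<sigma> X))) (real_set X))"
    using relative_homology_attachment[OF simplex_attachment_axioms, of p] by (simp add: infinite_cyclic_in_degree_def)
  have "kernel (homology_group p (top_of_set (real_set (insert \<sigma> X))))
     (relative_homology_group p (top_of_set (real_set (insert \<sigma> X))) (real_set X))
     (hom_induced p (top_of_set (real_set (insert \<sigma> X))) {} (top_of_set (real_set (insert \<sigma> X))) (real_set X) id)
    = carrier (homology_group p (top_of_set (real_set (insert \<sigma> X))))"
    by (rule group_hom.kernel_to_trivial_group[OF _ triv])
      (simp add: group_hom_def group_hom_axioms_def hom_induced_hom)
  then show ?thesis
    using inclusion_exact[of p]
    by (intro finite_rank_epi[OF abelian_homology_group abelian_homology_group hom_induced_hom _ assms]) simp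
qed

end

text \<open>Removing a maximal face undoes one attachment, until at most the empty face is
  left.\<close>

lemma finite_rank_homology:
  fixes K :: "'a::finite set set"
  assumes "face_closed K"
  shows "finite_rank (homology_group p (top_of_set (real_set K)))"
  using assms
proof (induction "card K" arbitrary: K rule: less_induct)
  case less
  show ?case
  proof (cases "K \<subseteq> {{}}")
    case True
    then show ?thesis
      by (intro finite_rank_trivial abelian_homology_group trivial_homology_group_empty)
        (simp add: real_set_trivial)
  next
    case False
    then obtain A where A: "A \<in> K" "A \<noteq> {}" by blast
    obtain \<sigma> where \<sigma>: "\<sigma> \<in> K" "A \<subseteq> \<sigma>" and max: "\<And>B. B \<in> K \<Longrightarrow> \<sigma> \<subseteq> B \<Longrightarrow> B = \<sigma>"
      using finite_has_maximal2[OF finite A(1)] by metis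
    have "\<sigma> \<noteq> {}" using A \<sigma> by blast
    then interpret simplex_attachment "K - {\<sigma>}" \<sigma>
      using simplex_attachment_facet[OF less.prems \<sigma>(1)] max by blast
    have "card (K - {\<sigma>}) < card K" using \<sigma>(1) by (intro psubset_card_mono) auto
    then have "finite_rank (homology_group p (top_of_set (real_set (K - {\<sigma>}))))"
      using less.hyps face_closed_X by blast
    then show ?thesis using finite_rank_attachment[of p] \<sigma>(1) by (simp add: insert_absorb)
  qed
qed

lemma (in simplex_attachment) attachment_not_homotopy_equivalent:
  "\<not> top_of_set (real_set X) homotopy_equivalent_space top_of_set (real_set (insert \<sigma> X))"
proof
  let ?X = "top_of_set (real_set X)" and ?K = "top_of_set (real_set (insert \<sigma> X))"
  assume "?X homotopy_equivalent_space ?K"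
  then have iso: "homology_group p ?X \<cong> homology_group p ?K" for p
    by (rule homotopy_equivalent_space_imp_isomorphic_homology_groups)
  \<comment> \<open>Degrees are integers, so \<open>d - 1\<close> also makes sense when
    \<open>\<sigma>\<close> is a vertex.\<close>
  define d where "d = int (card \<sigma>) - 1"
  have Z: "relative_homology_group d ?K (real_set X) \<cong> integer_group"
    using relative_homology_attachment[OF simplex_attachment_axioms, of d] by (simp add: infinite_cyclic_in_degree_def d_def)
  have triv: "trivial_group (relative_homology_group p ?K (real_set X))" if "p \<noteq> d" for p
    using relative_homology_attachment[OF simplex_attachment_axioms, of p] that by (simp add: infinite_cyclic_in_degree_def d_def)
  have fr: "finite_rank (homology_group p ?X)" for p
    by (rule finite_rank_homology[OF face_closed_X])
  have KX: "face_closed (insert \<sigma> X)"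
    using face_closed_X boundary unfolding face_closed_def by blast
  show False
  \<comment> \<open>\<open>A\<close> and \<open>B\<close> are the groups of \<open>X\<close> and
    \<open>K\<close> in degree \<open>d\<close>, \<open>Z\<close> is the relative group in degree
    \<open>d\<close>, and \<open>C\<close> and \<open>D\<close> are the groups of \<open>X\<close>
    and \<open>K\<close> in degree \<open>d - 1\<close>. Injectivity at \<open>A\<close> and
    surjectivity at \<open>D\<close> come from the vanishing relative groups in degrees
    \<open>d + 1\<close> and \<open>d - 1\<close>.\<close>
  proof (rule not_both_iso_of_exact_infinite_cyclic)
    show "inj_on (hom_induced d ?X {} ?K {} id) (carrier (homology_group d ?X))"
    proof -
      have "hom_boundary (d + 1) ?K (real_set X) ` carrier (relative_homology_group (d + 1) ?K (real_set X))
          = {\<one>\<^bsub>homology_group d ?X\<^esub>}"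
        using boundary_hom[of "d + 1"] triv[of "d + 1"]
        by (intro group_hom.image_from_trivial_group) (auto simp: group_hom_def group_hom_axioms_def)
      then have "kernel (homology_group d ?X) (homology_group d ?K) (hom_induced d ?X {} ?K {} id)
          = {\<one>\<^bsub>homology_group d ?X\<^esub>}"
        using boundary_exact_right[of "d + 1"] by simp
      then show ?thesis
        by (intro group_hom.trivial_ker_imp_inj) (auto simp: group_hom_def group_hom_axioms_def hom_induced_hom)
    qed
    show "hom_induced (d - 1) ?X {} ?K {} id ` carrier (homology_group (d - 1) ?X) = carrier (homology_group (d - 1) ?K)"
      unfolding inclusion_exact
      by (rule group_hom.kernel_to_trivial_group[OF _ triv])
        (simp_all add: group_hom_def group_hom_axioms_def hom_induced_hom)
    show "hom_induced d ?K {} ?K (real_set X) id (hom_induced d ?X {} ?K {} id x)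
        = \<one>\<^bsub>relative_homology_group d ?K (real_set X)\<^esub>" if "x \<in> carrier (homology_group d ?X)" for x
      using inclusion_exact[of d] that by (auto simp: kernel_def)
    show "hom_induced (d - 1) ?X {} ?K {} id (hom_boundary d ?K (real_set X) x)
        = \<one>\<^bsub>homology_group (d - 1) ?K\<^esub>" if "x \<in> carrier (relative_homology_group d ?K (real_set X))" for x
      using boundary_exact_right[of d] that by (auto simp: kernel_def)
    show "homology_group d ?K \<cong> homology_group d ?X"
      by (rule group.iso_sym[OF _ iso]) simp
    show "finite_rank (homology_group (d - 1) ?K)"
      by (rule finite_rank_homology[OF KX])
    show "kernel (relative_homology_group d ?K (real_set X)) (homology_group (d - 1) ?X) (hom_boundary d ?K (real_set X))
        = hom_induced d ?K {} ?K (real_set X) id ` carrier (homology_group d ?K)"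
      by (rule boundary_exact_left[symmetric])
  qed (use iso Z fr in \<open>simp_all add: hom_induced_hom boundary_hom abelian_homology_group\<close>)
qed

lemma realization_attachment_not_homotopy_equivalent:
  fixes X :: "'a::finite set set"
  assumes "face_closed X" "face_closed (insert \<sigma> X)" "\<sigma> \<notin> X"
  shows "\<not> realization X homotopy_equivalent_space realization (insert \<sigma> X)"
proof (cases "\<sigma> = {}")
  case True
  \<comment> \<open>A face-closed complex without the empty face is void. So a point is compared
    with the empty space, into which it has no map.\<close>
  then have "X = {}" using assms(1,3) by (auto simp: face_closed_def)
  show ?thesis
    unfolding True \<open>X = {}\<close> homotopy_equivalent_space_def
    by (auto simp: realization_eq real_set_trivial realization_def[of "{}"] continuous_map_def)
next
  case False
  have "{} \<in> X" using face_closedD[OF assms(2), of \<sigma> "{}"] False by auto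
  interpret simplex_attachment X \<sigma>
    by unfold_locales (use assms False face_closedD[OF assms(2), of \<sigma>] in auto)
  show ?thesis
    using attachment_not_homotopy_equivalent \<open>{} \<in> X\<close> by (subst (1 2) realization_eq) auto
qed

section \<open>The disjoint intervals\<close>

text \<open>The invariant of the construction of \<open>J\<close>: nonempty convex subsets of the
  chain \<open>V\<close>, none contained in another.\<close>

definition interval_system :: "'a::order set \<Rightarrow> 'a set set \<Rightarrow> bool" where
  "interval_system V I \<longleftrightarrow>
     (\<forall>A \<in> I. A \<noteq> {} \<and> A \<subseteq> V \<and> (\<forall>x \<in> A. \<forall>z \<in> A. \<forall>y \<in> V. x \<le> y \<and> y \<le> z \<longrightarrow> y \<in> A)) \<and>
     (\<forall>A \<in> I. \<forall>B \<in> I. A \<subseteq> B \<longrightarrow> A = B)"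

text \<open>One round of truncation and of deleting nonminimal intervals.\<close>

definition next_system :: "'a::order set set \<Rightarrow> 'a set set" where
  "next_system I = minimal_members (truncate_above (first_interval I) (I - {first_interval I}))"

definition hits :: "'a set \<Rightarrow> 'a set set \<Rightarrow> bool" where
  "hits h I \<longleftrightarrow> (\<forall>A \<in> I. h \<inter> A \<noteq> {})"

definition exact_on :: "'a::order set \<Rightarrow> 'a set \<Rightarrow> bool" where
  "exact_on h A \<longleftrightarrow> h \<inter> A = {lowest A}"

locale finite_chain =
  fixes V :: "'a::order set"
  assumes finite_V: "finite V" and total: "\<And>x y. x \<in> V \<Longrightarrow> y \<in> V \<Longrightarrow> x \<le> y \<or> y \<le> x"
begin

lemma ex_least:
  assumes "A \<subseteq> V" "A \<noteq> {}"
  shows "\<exists>x \<in> A. \<forall>y \<in> A. x \<le> y"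
proof -
  have "finite A" using assms(1) finite_V finite_subset by blast
  then obtain x where "x \<in> A" "\<forall>y \<in> A. y \<le> x \<longrightarrow> x = y"
    using finite_has_minimal[of A] assms(2) by blast
  then show ?thesis using total assms(1) by (metis subsetD)
qed

lemma lowest:
  assumes "A \<subseteq> V" "A \<noteq> {}"
  shows "lowest A \<in> A" "y \<in> A \<Longrightarrow> lowest A \<le> y"
proof -
  obtain x where x: "x \<in> A" "\<forall>y \<in> A. x \<le> y" using ex_least[OF assms] by blast
  then have "lowest A = x" unfolding lowest_def by (intro Least_equality) auto
  then show "lowest A \<in> A" "y \<in> A \<Longrightarrow> lowest A \<le> y" using x by auto
qed

end

locale chain_intervals = finite_chain V for V :: "'a::order set" +
  fixes I :: "'a set set"
  assumes system: "interval_system V I"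
begin

lemma finite_I: "finite I"
  using system finite_V by (intro finite_subset[of I "Pow V"]) (auto simp: interval_system_def)

lemma member: "A \<in> I \<Longrightarrow> A \<subseteq> V" "A \<in> I \<Longrightarrow> A \<noteq> {}"
  using system by (auto simp: interval_system_def)

lemma convex: "A \<in> I \<Longrightarrow> x \<in> A \<Longrightarrow> z \<in> A \<Longrightarrow> y \<in> V \<Longrightarrow> x \<le> y \<Longrightarrow> y \<le> z \<Longrightarrow> y \<in> A"
  using system unfolding interval_system_def by blast

lemma antichain: "A \<in> I \<Longrightarrow> B \<in> I \<Longrightarrow> A \<subseteq> B \<Longrightarrow> A = B"
  using system unfolding interval_system_def by blast

text \<open>Of two elements witnessing that neither set contains the other, the smaller lies between
  the common lowest element and the larger one, so convexity puts it into both sets.\<close>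

lemma eq_if_lowest_eq:
  assumes "A \<in> I" "B \<in> I" "lowest A = lowest B"
  shows "A = B"
proof -
  have "A \<subseteq> B \<or> B \<subseteq> A"
  proof (rule ccontr)
    assume "\<not> (A \<subseteq> B \<or> B \<subseteq> A)"
    then obtain a b where ab: "a \<in> A" "a \<notin> B" "b \<in> B" "b \<notin> A" by blast
    have inV: "a \<in> V" "b \<in> V" using ab assms member by blast+
    have low: "lowest A \<le> a" "lowest B \<le> b" "lowest A \<in> A" "lowest B \<in> B"
      using lowest member assms ab by blast+
    show False
    proof (cases "a \<le> b")
      case True
      then show False
        using convex[OF assms(2) low(4) ab(3) inV(1)] low(1) assms(3) ab(2) by simp
    next
      case False
      then have "b \<le> a" using total inV by blast
      then show False
        using convex[OF assms(1) low(3) ab(1) inV(2)] low(2) assms(3) ab(4) by simp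
    qed
  qed
  then show ?thesis using antichain assms by blast
qed

context
  assumes ne: "I \<noteq> {}"
begin

lemma first_interval: "first_interval I \<in> I" "B \<in> I \<Longrightarrow> lowest (first_interval I) \<le> lowest B"
proof -
  have "lowest ` I \<subseteq> V"
    using lowest(1)[OF member] member(1) by (intro image_subsetI) (meson subsetD)
  then obtain A where A: "A \<in> I" "\<forall>B \<in> I. lowest A \<le> lowest B"
    using ex_least[of "lowest ` I"] ne by auto
  have "first_interval I = A"
    unfolding first_interval_def
  proof (rule the_equality)
    fix B assume B: "B \<in> I \<and> (\<forall>C \<in> I. lowest B \<le> lowest C)"
    then have "lowest B = lowest A" using A by (intro order_antisym) auto
    then show "B = A" using eq_if_lowest_eq B A(1) by blast
  qed (use A in blast)
  then show "first_interval I \<in> I" "B \<in> I \<Longrightarrow> lowest (first_interval I) \<le> lowest B"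
    using A by auto
qed

text \<open>Otherwise \<open>B\<close> would start at the same element. Consequently toggling this
  element affects the first interval only.\<close>

lemma lowest_first_not_in:
  assumes "B \<in> I" "B \<noteq> first_interval I"
  shows "lowest (first_interval I) \<notin> B"
proof
  assume "lowest (first_interval I) \<in> B"
  then have "lowest B = lowest (first_interval I)"
    using first_interval(2)[OF assms(1)] lowest(2)[OF member[OF assms(1)]] by (intro order_antisym) auto
  then show False using eq_if_lowest_eq[OF assms(1) first_interval(1)] assms(2) by blast
qed

text \<open>\<open>B\<close> starts no lower than the first interval, which is convex. So truncation
  amounts to a set difference.\<close>

lemma above_first:
  assumes "B \<in> I" "B \<noteq> first_interval I" "x \<in> B" "x \<notin> first_interval I" "y \<in> first_interval I"
  shows "y < x"
proof -
  have V: "x \<in> V" "y \<in> V"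
    using member(1)[OF assms(1)] member(1)[OF first_interval(1)] assms(3,5) by blast+
  have "\<not> x \<le> y"
  proof
    assume "x \<le> y"
    moreover have "lowest (first_interval I) \<le> x"
      using first_interval(2)[OF assms(1)] lowest(2)[OF member[OF assms(1)] assms(3)] by simp
    ultimately show False
      using convex[OF first_interval(1) lowest(1)[OF member[OF first_interval(1)]] assms(5) V(1)] assms(4)
      by blast
  qed
  then show ?thesis using total V by fastforce
qed

lemma truncate_first:
  "truncate_above (first_interval I) (I - {first_interval I}) = (\<lambda>B. B - first_interval I) ` (I - {first_interval I})"
  unfolding truncate_above_def by (rule image_cong) (auto dest: above_first)

lemma next_system_member:
  assumes "C \<in> next_system I"
  obtains B where "B \<in> I" "B \<noteq> first_interval I" "C = B - first_interval I"
  using assms unfolding next_system_def truncate_first minimal_members_def by blast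

lemma next_above:
  assumes "C \<in> next_system I" "x \<in> C" "y \<in> first_interval I"
  shows "y < x"
  using assms above_first by (metis DiffE next_system_member)

text \<open>Truncated intervals stay nonempty by the antichain property, which passing to minimal
  members restores.\<close>

lemma next_interval_system: "interval_system V (next_system I)"
  unfolding interval_system_def
proof (intro conjI ballI impI)
  fix C assume C: "C \<in> next_system I"
  then obtain B where B: "B \<in> I" "B \<noteq> first_interval I" "C = B - first_interval I"
    by (rule next_system_member)
  show "C \<noteq> {}" using antichain[OF B(1) first_interval(1)] B by blast
  show "C \<subseteq> V" using B member by blast
  fix x z y assume xyz: "x \<in> C" "z \<in> C" "y \<in> V" "x \<le> y \<and> y \<le> z"
  then have "y \<in> B" using convex[OF B(1)] B(3) by blast
  moreover have "y \<notin> first_interval I"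
    using next_above[OF C xyz(1)] xyz(4) by (meson leD)
  ultimately show "y \<in> C" using B(3) by blast
next
  fix A B assume "A \<in> next_system I" "B \<in> next_system I" "A \<subseteq> B"
  then show "A = B" by (auto simp: next_system_def minimal_members_def)
qed

lemma card_next_system: "card (next_system I) < card I"
proof -
  have "card (next_system I) \<le> card ((\<lambda>B. B - first_interval I) ` (I - {first_interval I}))"
    unfolding next_system_def truncate_first minimal_members_def
    using finite_I by (intro card_mono) auto
  also have "\<dots> \<le> card (I - {first_interval I})" using finite_I by (intro card_image_le) simp
  also have "\<dots> < card I" using finite_I first_interval(1) by (intro psubset_card_mono) auto
  finally show ?thesis .
qed

lemma hits_next_system:
  assumes "exact_on h (first_interval I)"
  shows "hits h I \<longleftrightarrow> hits h (next_system I)"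
proof -
  let ?A = "first_interval I" and ?T = "(\<lambda>B. B - first_interval I) ` (I - {first_interval I})"
  have 1: "h \<inter> B = h \<inter> (B - ?A)" if "B \<in> I" "B \<noteq> ?A" for B
  proof -
    have "x \<notin> ?A" if "x \<in> h" "x \<in> B" for x
    proof
      assume "x \<in> ?A"
      then have "x \<in> {lowest ?A}" using that assms unfolding exact_on_def by (metis IntI)
      then show False using lowest_first_not_in[OF \<open>B \<in> I\<close> \<open>B \<noteq> ?A\<close>] \<open>x \<in> B\<close> by simp
    qed
    then show ?thesis by blast
  qed
  have "hits h I \<longleftrightarrow> hits h ?T"
  proof
    assume "hits h ?T"
    then have "h \<inter> (B - ?A) \<noteq> {}" if "B \<in> I" "B \<noteq> ?A" for B
      using that by (simp add: hits_def)
    then have "h \<inter> B \<noteq> {}" if "B \<in> I" "B \<noteq> ?A" for B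
      using 1[OF that] that by metis
    moreover have "h \<inter> ?A \<noteq> {}" using assms by (simp add: exact_on_def)
    ultimately show "hits h I" unfolding hits_def by metis
  next
    assume h: "hits h I"
    have "h \<inter> (B - ?A) \<noteq> {}" if "B \<in> I" "B \<noteq> ?A" for B
      using h 1[OF that] that unfolding hits_def by metis
    then show "hits h ?T" by (simp add: hits_def)
  qed
  \<comment> \<open>In a finite family each member contains a minimal one, so hitting the minimal
    members suffices.\<close>
  also have "\<dots> \<longleftrightarrow> hits h (minimal_members ?T)"
  proof
    assume m: "hits h (minimal_members ?T)"
    show "hits h ?T"
      unfolding hits_def
    proof
      fix B assume "B \<in> ?T"
      then obtain C where C: "C \<in> ?T" "C \<subseteq> B" "\<forall>D \<in> ?T. D \<subseteq> C \<longrightarrow> C = D"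
        using finite_has_minimal2[of ?T B] finite_I by blast
      then have "C \<in> minimal_members ?T" by (auto simp: minimal_members_def)
      then show "h \<inter> B \<noteq> {}" using m C(2) unfolding hits_def by blast
    qed
  qed (auto simp: hits_def minimal_members_def)
  finally show ?thesis by (simp add: next_system_def truncate_first)
qed

end

end

text \<open>The loop as a relation: the list keeps the order of selection, which the set
  \<open>J\<close> forgets, and a derivation witnesses termination.\<close>

inductive selects :: "'a::order set set \<Rightarrow> 'a set list \<Rightarrow> bool" where
  Nil: "selects {} []"
| Cons: "I \<noteq> {} \<Longrightarrow> selects (next_system I) js \<Longrightarrow> selects I (first_interval I # js)"

lemma disjoint_intervals_selects:
  assumes "selects I js"
  shows "disjoint_intervals I = set js"
proof -
  \<comment> \<open>Generalized to an arbitrary accumulator \<open>J\<close>, as the loop does not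
    stay at the empty one.\<close>
  have "snd (while (\<lambda>(I, J). I \<noteq> {})
            (\<lambda>(I, J). let A = first_interval I in
               (minimal_members (truncate_above A (I - {A})), insert A J)) (I, J)) = set js \<union> J" for J
    using assms
  proof (induction arbitrary: J)
    case Nil
    show ?case by (subst while_unfold) simp
  next
    case (Cons I js)
    show ?case
      using Cons.hyps(1) Cons.IH[of "insert (first_interval I) J"]
      by (subst while_unfold) (simp add: Let_def next_system_def)
  qed
  then show ?thesis by (simp add: disjoint_intervals_def)
qed

section \<open>Faces and the selected intervals\<close>

context finite_chain
begin

lemma ex_selects:
  assumes "interval_system V I"
  shows "\<exists>js. selects I js"
  using assms
proof (induction "card I" arbitrary: I rule: less_induct)
  case less
  interpret chain_intervals V I using less.prems by unfold_locales
  show ?case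
  proof (cases "I = {}")
    case False
    then obtain js where "selects (next_system I) js"
      using less.hyps[OF card_next_system next_interval_system] by blast
    then show ?thesis using selects.Cons False by blast
  qed (use selects.Nil in auto)
qed

lemma selects_nonempty:
  assumes "selects I js" "interval_system V I" "j \<in> set js"
  shows "j \<noteq> {}"
  using assms
proof (induction arbitrary: j)
  case (Cons I js)
  interpret chain_intervals V I using Cons.prems by unfold_locales
  note ne = Cons.hyps(1)
  show ?case
    using Cons.IH[OF next_interval_system[OF ne]] Cons.prems(2) member(2)[OF first_interval(1)[OF ne]] by auto
qed auto

lemma selects_subset:
  assumes "selects I js" "interval_system V I" "j \<in> set js"
  shows "\<exists>B \<in> I. j \<subseteq> B"
  using assms
proof (induction arbitrary: j)
  case (Cons I js)
  interpret chain_intervals V I using Cons.prems by unfold_locales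
  note ne = Cons.hyps(1)
  show ?case
  proof (cases "j = first_interval I")
    case True
    then show ?thesis using first_interval(1)[OF ne] by blast
  next
    case False
    then have "j \<in> set js" using Cons.prems(2) by simp
    then obtain C where C: "C \<in> next_system I" "j \<subseteq> C"
      using Cons.IH[OF next_interval_system[OF ne]] by blast
    obtain B where "B \<in> I" "C = B - first_interval I"
      by (rule next_system_member[OF ne C(1)])
    then show ?thesis using C(2) by blast
  qed
qed auto

lemma selects_subset_V:
  assumes "selects I js" "interval_system V I" "j \<in> set js"
  shows "j \<subseteq> V"
  using selects_subset[OF assms] assms(2) unfolding interval_system_def by (meson order_trans)

lemma selects_lowest_in:
  assumes "selects I js" "interval_system V I" "j \<in> set js"
  shows "lowest j \<in> j"
  by (rule lowest(1)[OF selects_subset_V[OF assms] selects_nonempty[OF assms]])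

lemma selects_increasing:
  assumes "selects I js" "interval_system V I" "k < l" "l < length js" "x \<in> js ! k" "y \<in> js ! l"
  shows "x < y"
  using assms
proof (induction arbitrary: k l)
  case (Cons I js)
  interpret chain_intervals V I using Cons.prems(1) by unfold_locales
  note ne = Cons.hyps(1)
  obtain l' where l: "l = Suc l'" "l' < length js" using Cons.prems(2,3) by (cases l) auto
  have y: "y \<in> js ! l'" using Cons.prems(5) l by simp
  show ?case
  proof (cases k)
    case 0
    then have x: "x \<in> first_interval I" using Cons.prems(4) by simp
    obtain C where "C \<in> next_system I" "js ! l' \<subseteq> C"
      using selects_subset[OF Cons.hyps(2) next_interval_system[OF ne] nth_mem[OF l(2)]] by blast
    then show ?thesis using next_above[OF ne _ _ x] y by blast
  next
    case (Suc k')
    then show ?thesis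
      using Cons.IH[OF next_interval_system[OF ne] _ l(2) _ y, of k'] Cons.prems(2,4) l by simp
  qed
qed simp

text \<open>Exactness on the earlier intervals carries hitting along to the system in which the
  \<open>k\<close>-th interval is selected, and there it is a member.\<close>

lemma selects_meets:
  assumes "selects I js" "interval_system V I" "k < length js" "\<And>l. l < k \<Longrightarrow> exact_on h (js ! l)"
    and "hits h I"
  shows "h \<inter> js ! k \<noteq> {}"
  using assms
proof (induction arbitrary: k)
  case (Cons I js)
  interpret chain_intervals V I using Cons.prems(1) by unfold_locales
  note ne = Cons.hyps(1)
  show ?case
  proof (cases k)
    case 0
    then show ?thesis using Cons.prems(4) first_interval(1)[OF ne] by (simp add: hits_def)
  next
    case (Suc k')
    have "exact_on h (first_interval I)" using Cons.prems(3)[of 0] Suc by simp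
    then have "hits h (next_system I)" using hits_next_system[OF ne] Cons.prems(4) by blast
    moreover have "exact_on h (js ! l)" if "l < k'" for l
      using Cons.prems(3)[of "Suc l"] that Suc by simp
    ultimately have "h \<inter> js ! k' \<noteq> {}"
      using Cons.IH[OF next_interval_system[OF ne], of k'] Cons.prems(2) Suc by simp
    then show ?thesis using Suc by simp
  qed
qed simp

text \<open>At the first inexact interval \<open>h\<close> has an element besides the lowest, which
  survives the toggle, and no other interval of that stage contains the toggled vertex. At earlier
  stages the vertex lies outside the exact interval, so hitting transfers back.\<close>

lemma selects_hits_toggle:
  assumes "selects I js" "interval_system V I" "k < length js" "\<And>l. l < k \<Longrightarrow> exact_on h (js ! l)"
    and "hits h I" "\<not> exact_on h (js ! k)"
  shows "hits (toggle (lowest (js ! k)) h) I"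
  using assms
proof (induction arbitrary: k)
  case (Cons I js)
  interpret chain_intervals V I using Cons.prems(1) by unfold_locales
  note ne = Cons.hyps(1)
  let ?A = "first_interval I"
  have A: "?A \<in> I" by (rule first_interval(1)[OF ne])
  show ?case
  proof (cases k)
    case 0
    let ?g = "toggle (lowest ?A) h"
    have "h \<inter> ?A \<noteq> {}" using Cons.prems(4) A by (simp add: hits_def)
    moreover have "h \<inter> ?A \<noteq> {lowest ?A}"
      using Cons.prems(5) 0 by (simp add: exact_on_def)
    ultimately have "\<not> h \<inter> ?A \<subseteq> {lowest ?A}" using subset_singletonD by metis
    then obtain x where "x \<in> h \<inter> ?A" "x \<noteq> lowest ?A" by blast
    then have "x \<in> ?g \<inter> ?A" by (simp add: toggle_def)
    then have "?g \<inter> ?A \<noteq> {}" by blast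
    moreover have "?g \<inter> B \<noteq> {}" if B: "B \<in> I" "B \<noteq> ?A" for B
    proof -
      obtain x where "x \<in> h" "x \<in> B" using Cons.prems(4) B(1) unfolding hits_def by blast
      moreover from this have "x \<noteq> lowest ?A" using lowest_first_not_in[OF ne B] by metis
      ultimately have "x \<in> ?g \<inter> B" by (simp add: toggle_def)
      then show ?thesis by blast
    qed
    ultimately have "hits ?g I" unfolding hits_def by metis
    then show ?thesis using 0 by simp
  next
    case (Suc k')
    let ?v = "lowest (js ! k')"
    have k': "k' < length js" using Cons.prems(2) Suc by simp
    have ex: "exact_on h ?A" using Cons.prems(3)[of 0] Suc by simp
    then have "hits h (next_system I)" using hits_next_system[OF ne] Cons.prems(4) by blast
    moreover have "exact_on h (js ! l)" if "l < k'" for l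
      using Cons.prems(3)[of "Suc l"] that Suc by simp
    ultimately have h: "hits (toggle ?v h) (next_system I)"
      using Cons.IH[OF next_interval_system[OF ne] k'] Cons.prems(5) Suc by simp
    obtain C where C: "C \<in> next_system I" "js ! k' \<subseteq> C"
      using selects_subset[OF Cons.hyps(2) next_interval_system[OF ne] nth_mem[OF k']] by blast
    have v: "?v \<in> js ! k'"
      by (rule selects_lowest_in[OF Cons.hyps(2) next_interval_system[OF ne] nth_mem[OF k']])
    then have "?v \<notin> ?A" using next_above[OF ne C(1)] C(2) by blast
    then have "toggle ?v h \<inter> ?A = h \<inter> ?A" unfolding toggle_def by (cases "?v \<in> h") force+
    then have "exact_on (toggle ?v h) ?A" using ex by (simp add: exact_on_def)
    then show ?thesis using hits_next_system[OF ne] h Suc by simp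
  qed
qed simp

text \<open>Selection ends with the empty system, which every face hits; exactness carries this back
  to \<open>I\<close>.\<close>

lemma selects_exact_hits:
  assumes "selects I js" "interval_system V I" "\<And>j. j \<in> set js \<Longrightarrow> exact_on h j"
  shows "hits h I"
  using assms
proof induction
  case (Cons I js)
  interpret chain_intervals V I using Cons.prems by unfold_locales
  show ?case
    using Cons.IH[OF next_interval_system[OF Cons.hyps(1)]] Cons.prems
      hits_next_system[OF Cons.hyps(1)] by simp
qed (simp add: hits_def)

end

section \<open>Splicing facets\<close>

lemma facetsD:
  fixes A :: "'a::{finite,order_bot,order_top} set"
  assumes "A \<in> facets"
  shows "bot \<notin> A" "top \<notin> A" "x \<in> A \<Longrightarrow> y \<in> A \<Longrightarrow> x \<le> y \<or> y \<le> x"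
    and "z \<noteq> bot \<Longrightarrow> z \<noteq> top \<Longrightarrow> (\<And>x. x \<in> A \<Longrightarrow> x \<le> z \<or> z \<le> x) \<Longrightarrow> z \<in> A"
proof -
  have A: "A \<subseteq> UNIV - {bot, top}" "Complete_Partial_Order.chain (\<le>) A"
    and max: "\<And>B. B \<in> order_complex \<Longrightarrow> A \<subseteq> B \<Longrightarrow> A = B"
    using assms by (auto simp: facets_def order_complex_def)
  show "bot \<notin> A" "top \<notin> A" using A(1) by auto
  show "x \<in> A \<Longrightarrow> y \<in> A \<Longrightarrow> x \<le> y \<or> y \<le> x" using A(2) unfolding chain_def by metis
  assume z: "z \<noteq> bot" "z \<noteq> top" "\<And>x. x \<in> A \<Longrightarrow> x \<le> z \<or> z \<le> x"
  have "Complete_Partial_Order.chain (\<le>) (insert z A)"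
    using A(2) z(3) unfolding chain_def by (metis insert_iff order_refl)
  then have "insert z A \<in> order_complex" using A(1) z by (auto simp: order_complex_def)
  then show "z \<in> A" using max by blast
qed

lemma facetsI:
  fixes A :: "'a::{finite,order_bot,order_top} set"
  assumes "bot \<notin> A" "top \<notin> A" and chain: "\<And>x y. x \<in> A \<Longrightarrow> y \<in> A \<Longrightarrow> x \<le> y \<or> y \<le> x"
    and max: "\<And>z. z \<noteq> bot \<Longrightarrow> z \<noteq> top \<Longrightarrow> (\<And>x. x \<in> A \<Longrightarrow> x \<le> z \<or> z \<le> x) \<Longrightarrow> z \<in> A"
  shows "A \<in> facets"
  unfolding facets_def
proof (intro CollectI conjI ballI impI)
  show "A \<in> order_complex"
    using assms(1,2) chain unfolding order_complex_def chain_def by blast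
  fix B assume B: "B \<in> order_complex" "A \<subseteq> B"
  have "z \<in> A" if "z \<in> B" for z
    using B that by (intro max) (auto simp: order_complex_def chain_def)
  then show "A = B" using B(2) by blast
qed

lemma facet_subset_eq:
  fixes A B :: "'a::{finite,order_bot,order_top} set"
  assumes "A \<in> facets" "B \<in> facets" "A \<subseteq> B"
  shows "A = B"
  using assms by (auto simp: facets_def)

section \<open>Ranks along a chain and its initial segments\<close>

context finite_chain
begin

lemma finite_chain_subset:
  assumes "C \<subseteq> V"
  shows "finite_chain C"
proof
  show "finite C" by (rule finite_subset[OF assms finite_V])
  show "x \<le> y \<or> y \<le> x" if "x \<in> C" "y \<in> C" for x y using total assms that by blast
qed

lemma rank_in_inj:
  assumes "u \<in> V" "w \<in> V" "rank_in V u = rank_in V w"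
  shows "u = w"
proof -
  have less: "rank_in V x < rank_in V y" if "x \<in> V" "y \<in> V" "x < y" for x y
    unfolding rank_in_def
  proof (rule psubset_card_mono)
    have "y \<in> {v \<in> V. v \<le> y} - {v \<in> V. v \<le> x}"
      using that by (simp add: less_le_not_le)
    moreover have "{v \<in> V. v \<le> x} \<subseteq> {v \<in> V. v \<le> y}"
      using that(3) by (auto intro: order_trans less_imp_le)
    ultimately show "{v \<in> V. v \<le> x} \<subset> {v \<in> V. v \<le> y}" by blast
  qed (simp add: finite_V)
  show ?thesis
    using less assms total by (metis less_irrefl order_le_less)
qed

lemma vertex_at_eq:
  assumes "u \<in> V" "rank_in V u = i"
  shows "vertex_at V i = u"
  unfolding vertex_at_def using assms rank_in_inj by blast

lemma rank_in_image: "rank_in V ` V = {1..card V}"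
proof (rule card_subset_eq)
  show "rank_in V ` V \<subseteq> {1..card V}"
  proof
    fix n assume "n \<in> rank_in V ` V"
    then obtain u where u: "u \<in> V" "n = card {v \<in> V. v \<le> u}" by (auto simp: rank_in_def)
    have "card {v \<in> V. v \<le> u} \<le> card V" using finite_V by (intro card_mono) auto
    moreover have "card {v \<in> V. v \<le> u} > 0" using finite_V u(1) by (auto simp: card_gt_0_iff)
    ultimately show "n \<in> {1..card V}" using u by simp
  qed
  have "inj_on (rank_in V) V" by (intro inj_onI rank_in_inj)
  then show "card (rank_in V ` V) = card {1..card V}" by (simp add: card_image)
qed simp

text \<open>The rank of an element counts only what lies below it, so it can be computed in
  \<open>C\<close>. Facets with a common initial segment therefore agree at its ranks.\<close>

lemma vertex_at_initial_segment:
  assumes C: "C \<subseteq> V" "\<And>x y. x \<in> C \<Longrightarrow> y \<in> V \<Longrightarrow> y \<le> x \<Longrightarrow> y \<in> C" and "l \<in> {1..card C}"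
  shows "vertex_at V l = vertex_at C l" "vertex_at C l \<in> C"
proof -
  interpret C: finite_chain C by (rule finite_chain_subset[OF C(1)])
  have "l \<in> rank_in C ` C" unfolding C.rank_in_image by (rule assms(3))
  then obtain u where u: "u \<in> C" "rank_in C u = l" by blast
  have "{v \<in> V. v \<le> u} = {v \<in> C. v \<le> u}" using C(1) C(2)[OF u(1)] by blast
  then have "rank_in V u = l" using u(2) by (simp add: rank_in_def)
  then show "vertex_at V l = vertex_at C l" "vertex_at C l \<in> C"
    using vertex_at_eq[of u l] C.vertex_at_eq[OF u] u(1) subsetD[OF C(1) u(1)] by simp_all
qed

lemma vertex_at_image_initial_segment:
  assumes C: "C \<subseteq> V" "\<And>x y. x \<in> C \<Longrightarrow> y \<in> V \<Longrightarrow> y \<le> x \<Longrightarrow> y \<in> C"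
  shows "vertex_at V ` {1..card C} = C"
proof -
  interpret C: finite_chain C by (rule finite_chain_subset[OF C(1)])
  have "u \<in> vertex_at V ` {1..card C}" if "u \<in> C" for u
  proof -
    have "rank_in C u \<in> {1..card C}"
      unfolding C.rank_in_image[symmetric] using that by (rule imageI)
    moreover from this have "vertex_at V (rank_in C u) = u"
      using vertex_at_initial_segment(1)[OF C] C.vertex_at_eq[OF that refl] by simp
    ultimately show ?thesis by (metis imageI)
  qed
  moreover have "vertex_at V l \<in> C" if "l \<in> {1..card C}" for l
    using vertex_at_initial_segment[OF C that] by simp
  ultimately show ?thesis by blast
qed

lemma vertex_at_Suc_initial_segment:
  assumes C: "C \<subseteq> V" "\<And>x y. x \<in> C \<Longrightarrow> y \<in> V \<Longrightarrow> y \<le> x \<Longrightarrow> y \<in> C"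
    and a: "a \<in> V - C" "\<And>y. y \<in> V - C \<Longrightarrow> a \<le> y"
  shows "vertex_at V (Suc (card C)) = a"
proof (rule vertex_at_eq)
  have "{v \<in> V. v \<le> a} = insert a C"
  proof (intro equalityI subsetI)
    fix x assume x: "x \<in> insert a C"
    then have "x \<in> V" using C(1) a(1) by blast
    moreover have "x \<le> a"
    proof (cases "x = a")
      case False
      then have "\<not> a \<le> x" using C(2)[of x a] a(1) x by blast
      then show ?thesis using total[OF \<open>x \<in> V\<close>, of a] a(1) by blast
    qed simp
    ultimately show "x \<in> {v \<in> V. v \<le> a}" by simp
  next
    fix x assume "x \<in> {v \<in> V. v \<le> a}"
    then show "x \<in> insert a C" using a(2)[of x] order_antisym[of x a] by blast
  qed
  then show "rank_in V a = Suc (card C)"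
    using a(1) finite_subset[OF C(1) finite_V] by (simp add: rank_in_def)
qed (use a in simp)

end

lemma finite_chain_facet: "A \<in> facets \<Longrightarrow> finite_chain A"
  by unfold_locales (use facetsD(3) in auto)

text \<open>\<open>C\<close> is the common initial segment of the facets \<open>A\<close> and \<open>B\<close>, and \<open>e\<close> the first
  element above it at which they meet again. Following \<open>A\<close> up to \<open>e\<close> and \<open>B\<close> from there on
  gives a facet that diverges from \<open>B\<close> exactly as \<open>A\<close> does.\<close>

lemma lexicographic_swap:
  fixes F :: "nat \<Rightarrow> 'a::{finite,order_bot,order_top} set"
  assumes lex: "lexicographic_order F N" and ik: "i \<in> {1..N}" "k \<in> {1..N}" "i < k"
  shows "\<exists>c \<in> {1..<k}. F i \<inter> F k \<subseteq> F c \<and>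
    (\<forall>x \<in> F k - F c. \<forall>z \<in> F k - F c. \<forall>y \<in> F k. x \<le> y \<and> y \<le> z \<longrightarrow> y \<notin> F c)"
proof -
  define A B where "A = F i" and "B = F k"
  have bij: "bij_betw F {1..N} facets" using lex by (simp add: lexicographic_order_def)
  then have im: "F ` {1..N} = facets" and inj: "inj_on F {1..N}" by (simp_all add: bij_betw_def)
  have facet: "A \<in> facets" "B \<in> facets"
    unfolding im[symmetric] A_def B_def using ik(1,2) by (simp_all only: imageI)
  have AB: "A \<noteq> B" using inj_onD[OF inj _ ik(1,2)] ik(3) by (metis A_def B_def less_irrefl)
  interpret A: finite_chain A by (rule finite_chain_facet[OF facet(1)])
  interpret B: finite_chain B by (rule finite_chain_facet[OF facet(2)])
  define C where "C = {x \<in> A \<inter> B. \<forall>y. y \<le> x \<longrightarrow> y \<in> A \<longleftrightarrow> y \<in> B}"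
  have CA: "C \<subseteq> A" and segA: "\<And>x y. x \<in> C \<Longrightarrow> y \<in> A \<Longrightarrow> y \<le> x \<Longrightarrow> y \<in> C"
    unfolding C_def by (blast, blast intro: order_trans)
  have CB: "C \<subseteq> B" and segB: "\<And>x y. x \<in> C \<Longrightarrow> y \<in> B \<Longrightarrow> y \<le> x \<Longrightarrow> y \<in> C"
    unfolding C_def by (blast, blast intro: order_trans)
  have "A - C \<noteq> {}" using facet_subset_eq[OF facet] AB CA CB by blast
  then obtain a where a: "a \<in> A - C" "\<And>y. y \<in> A - C \<Longrightarrow> a \<le> y" using A.ex_least[of "A - C"] by blast
  have "B - C \<noteq> {}" using facet_subset_eq[OF facet(2,1)] AB CA CB by blast
  then obtain b where b: "b \<in> B - C" "\<And>y. y \<in> B - C \<Longrightarrow> b \<le> y" using B.ex_least[of "B - C"] by blast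
  have Ca: "x < a" if "x \<in> C" for x
    using that a(1) CA segA A.total by (metis DiffD1 DiffD2 order_le_less subsetD)
  have Cb: "x < b" if "x \<in> C" for x
    using that b(1) CB segB B.total by (metis DiffD1 DiffD2 order_le_less subsetD)
  have ab: "a \<noteq> b"
  proof
    assume eq: "a = b"
    have "y \<in> A \<longleftrightarrow> y \<in> B" if "y \<le> a" for y
    proof (cases "y \<in> C")
      case False
      then show ?thesis using that a b eq by (metis DiffD1 DiffI order_antisym)
    qed (use CA CB in blast)
    then have "a \<in> C" using a(1) b(1) eq unfolding C_def by blast
    then show False using a(1) by blast
  qed
  \<comment> \<open>If \<open>a\<close> were in \<open>B\<close>, then \<open>b < a\<close> would be
    comparable with all of \<open>A\<close>: it is above \<open>C\<close> and below everything else.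
    Maximality would put \<open>b\<close> into \<open>A\<close>, below the least element of
    \<open>A - C\<close>.\<close>
  have "a \<notin> B"
  proof
    assume "a \<in> B"
    then have "b < a" using b(2) a(1) ab by (metis DiffD2 DiffI order_le_less)
    have "b \<in> A"
    proof (rule facetsD(4)[OF facet(1)])
      show "b \<noteq> bot" "b \<noteq> top" using b(1) facetsD(1,2)[OF facet(2)] by blast+
      fix x assume "x \<in> A"
      then show "x \<le> b \<or> b \<le> x"
        using Cb a(2) \<open>b < a\<close> by (cases "x \<in> C") (auto intro: less_imp_le order_trans)
    qed
    then show False using a(2)[of b] b(1) \<open>b < a\<close> by auto
  qed
  \<comment> \<open>\<open>top\<close> serves as default when the facets never meet again above
    \<open>C\<close>; the spliced facet is then \<open>A\<close> itself.\<close>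
  have "\<exists>e \<in> insert top (A \<inter> B - C). \<forall>y \<in> insert top (A \<inter> B - C). e \<le> y"
  proof (cases "A \<inter> B - C = {}")
    case False
    moreover have "A \<inter> B - C \<subseteq> A" by blast
    ultimately obtain m where "m \<in> A \<inter> B - C" "\<forall>y \<in> A \<inter> B - C. m \<le> y"
      using A.ex_least by metis
    then show ?thesis by (intro bexI[of _ m]) simp_all
  next
    case True
    then show ?thesis unfolding True by simp
  qed
  then obtain e where e: "e = top \<or> e \<in> A \<inter> B - C" "\<And>y. y \<in> A \<Longrightarrow> y \<in> B \<Longrightarrow> y \<notin> C \<Longrightarrow> e \<le> y"
    by blast
  have eA: "x \<le> e \<or> e \<le> x" if "x \<in> A" for x using e(1) that A.total[of x e] by auto
  have eB: "x \<le> e \<or> e \<le> x" if "x \<in> B" for x using e(1) that B.total[of x e] by auto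
  have ae: "a < e"
    using e(1) a \<open>a \<notin> B\<close> facetsD(2)[OF facet(1)]
    by (metis DiffD1 DiffD2 DiffI IntD1 IntD2 order_le_less top_greatest)
  define W where "W = {x \<in> A. x < e} \<union> {x \<in> B. e \<le> x}"
  have W: "W \<in> facets"
  proof (rule facetsI)
    show "bot \<notin> W" "top \<notin> W" using facetsD(1,2)[OF facet(1)] facetsD(1,2)[OF facet(2)] by (auto simp: W_def)
    show "x \<le> y \<or> y \<le> x" if "x \<in> W" "y \<in> W" for x y
      using that A.total[of x y] B.total[of x y] unfolding W_def by (auto dest: less_imp_le intro: order_trans)
    fix z assume z: "z \<noteq> bot" "z \<noteq> top" "\<And>x. x \<in> W \<Longrightarrow> x \<le> z \<or> z \<le> x"
    \<comment> \<open>Comparability with \<open>e\<close> decides which facet's maximality applies: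
      below \<open>e\<close> that of \<open>A\<close>, from \<open>e\<close> on that of
      \<open>B\<close>.\<close>
    have "z \<le> e \<or> e \<le> z"
    proof (cases "e = top")
      case False
      then have "e \<in> W" using e(1) by (auto simp: W_def)
      then show ?thesis using z(3) by blast
    qed simp
    then consider "z < e" | "e \<le> z" by (metis order_le_less)
    then show "z \<in> W"
    proof cases
      case 1
      have "z \<in> A"
      proof (rule facetsD(4)[OF facet(1) z(1,2)])
        fix x assume x: "x \<in> A"
        show "x \<le> z \<or> z \<le> x"
        proof (cases "x < e")
          case True then show ?thesis using x z(3) by (simp add: W_def)
        next
          case False
          then have "e \<le> x" using eA[OF x] by (auto simp: order_le_less)
          then show ?thesis using 1 by (meson less_imp_le order_trans)
        qed
      qed
      then show ?thesis using 1 by (simp add: W_def)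
    next
      case 2
      have "z \<in> B"
      proof (rule facetsD(4)[OF facet(2) z(1,2)])
        fix x assume x: "x \<in> B"
        show "x \<le> z \<or> z \<le> x"
        proof (cases "e \<le> x")
          case True then show ?thesis using x z(3) by (simp add: W_def)
        next
          case False
          then have "x \<le> e" using eB[OF x] by blast
          then show ?thesis using 2 by (meson order_trans)
        qed
      qed
      then show ?thesis using 2 by (simp add: W_def)
    qed
  qed
  then have "W \<in> F ` {1..N}" unfolding im .
  then obtain c where c: "c \<in> {1..N}" "F c = W" by (metis imageE)
  have ck: "c < k"
  proof -
    \<comment> \<open>Ranks start at 1, so \<open>C\<close> fills the ranks up to
      \<open>card C\<close> and the facets diverge at \<open>Suc (card C)\<close>, into
      \<open>a\<close> and \<open>b\<close>.\<close>
    have card: "card C < card A" "card C < card B"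
      using a(1) b(1) CA CB A.finite_V B.finite_V by (auto intro!: psubset_card_mono)
    have eq: "\<forall>l \<in> {1..card C}. vertex_at A l = vertex_at B l"
      using A.vertex_at_initial_segment(1)[OF CA segA] B.vertex_at_initial_segment(1)[OF CB segB] by simp
    have Sa: "vertex_at A (Suc (card C)) = a" by (rule A.vertex_at_Suc_initial_segment[OF CA segA a])
    have Sb: "vertex_at B (Suc (card C)) = b" by (rule B.vertex_at_Suc_initial_segment[OF CB segB b])
    have vA: "vertex_at A ` {1..card C} = C"
      by (rule A.vertex_at_image_initial_segment[OF CA]) (rule segA)
    have vB: "vertex_at B ` {1..card C} = C"
      by (rule B.vertex_at_image_initial_segment[OF CB]) (rule segB)
    have iv: "{1..Suc (card C)} = insert (Suc (card C)) {1..card C}" by auto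
    have "vertex_at A ` {1..Suc (card C)} = insert a C"
      unfolding iv image_insert vA Sa ..
    moreover have "vertex_at B ` {1..Suc (card C)} = insert b C"
      unfolding iv image_insert vB Sb ..
    moreover have "insert a C \<subseteq> F c"
      using c(2) a(1) ae Ca CA by (auto simp: W_def intro: less_trans)
    moreover have "insert b C \<subseteq> F k" using b(1) CB by (auto simp: B_def)
    ultimately show "c < k"
      using lex[unfolded lexicographic_order_def, THEN conjunct2, rule_format, of i k "card C" c k]
        card eq Sa Sb ab ik c(1) unfolding A_def B_def by simp
  qed
  have sub: "F i \<inter> F k \<subseteq> F c"
  proof
    fix x assume x: "x \<in> F i \<inter> F k"
    then have "x < e \<or> e \<le> x" using eA[of x] by (auto simp: A_def order_le_less)
    then show "x \<in> F c" using x c(2) by (auto simp: W_def A_def B_def)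
  qed
  \<comment> \<open>Missing from \<open>F c\<close> are exactly the elements of \<open>B\<close>
    that lie above \<open>C\<close> and not above \<open>e\<close>: an interval of
    \<open>B\<close>.\<close>
  have conv: "y \<notin> F c" if "x \<in> F k - F c" "z \<in> F k - F c" "y \<in> F k" "x \<le> y" "y \<le> z" for x y z
  proof
    assume "y \<in> F c"
    have z: "z \<in> B" "\<not> e \<le> z" and x: "x \<in> B" "\<not> e \<le> x" "x \<notin> C"
      using that(1,2) c(2) Ca ae CA by (auto simp: W_def B_def intro: less_trans)
    have "\<not> e \<le> y" using z(2) that(5) by (meson order_trans)
    then have "y \<in> A" using \<open>y \<in> F c\<close> c(2) by (auto simp: W_def)
    then have "y \<in> C" using e(2)[of y] that(3) \<open>\<not> e \<le> y\<close> by (auto simp: B_def)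
    then show False using segB[OF _ x(1) that(4)] x(3) by blast
  qed
  have "c \<in> {1..<k}" using c(1) ck by simp
  then show ?thesis
    by (intro bexI[of _ c] conjI ballI impI sub) (erule conjE, rule conv)
qed

section \<open>New faces and the interval system of a facet\<close>

lemma earlier_complex_face_closed: "face_closed (earlier_complex F k)"
  by (auto simp: face_closed_def earlier_complex_def)

text \<open>A face is old iff some maximal old face \<open>G\<close> contains it, that is, iff it
  misses the complement of \<open>G\<close> in \<open>F k\<close>.\<close>

lemma new_faces_eq_hits:
  fixes F :: "nat \<Rightarrow> 'a::finite set"
  shows "new_faces F k = {h. h \<subseteq> F k \<and> hits h (I_intervals F k)}"
proof -
  let ?E = "Pow (F k) \<inter> earlier_complex F k"
  have "h \<notin> earlier_complex F k \<longleftrightarrow> hits h (I_intervals F k)" if h: "h \<subseteq> F k" for h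
  proof
    assume *: "h \<notin> earlier_complex F k"
    show "hits h (I_intervals F k)"
      unfolding hits_def
    proof
      fix A assume "A \<in> I_intervals F k"
      then obtain G where G: "A = F k - G" "G \<in> ?E" by (auto simp: I_intervals_def)
      show "h \<inter> A \<noteq> {}"
      proof
        assume "h \<inter> A = {}"
        then have "h \<subseteq> G" using h G(1) by blast
        then show False using * G(2) face_closedD[OF earlier_complex_face_closed] by blast
      qed
    qed
  next
    assume *: "hits h (I_intervals F k)"
    show "h \<notin> earlier_complex F k"
    proof
      assume "h \<in> earlier_complex F k"
      then have "h \<in> ?E" using h by blast
      then obtain G where G: "G \<in> ?E" "h \<subseteq> G" "\<forall>H \<in> ?E. G \<subseteq> H \<longrightarrow> G = H"
        using finite_has_maximal2[of ?E h] by auto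
      then have "F k - G \<in> I_intervals F k" unfolding I_intervals_def by blast
      then show False using * G(2) unfolding hits_def by blast
    qed
  qed
  then show ?thesis unfolding new_faces_def by blast
qed

text \<open>A maximal old face lies in \<open>F c \<inter> F k\<close> for a spliced facet
  \<open>F c\<close> and equals it by maximality, so its complement is convex. It is nonempty since
  distinct facets are incomparable.\<close>

lemma I_intervals_system:
  fixes F :: "nat \<Rightarrow> 'a::{finite,order_bot,order_top} set"
  assumes lex: "lexicographic_order F N" and k: "k \<in> {1..N}"
  shows "interval_system (F k) (I_intervals F k)"
  unfolding interval_system_def
proof (intro conjI ballI impI)
  fix A assume "A \<in> I_intervals F k"
  then obtain G where G: "A = F k - G" "G \<subseteq> F k" "G \<in> earlier_complex F k"
    and max: "\<And>H. H \<subseteq> F k \<Longrightarrow> H \<in> earlier_complex F k \<Longrightarrow> G \<subseteq> H \<Longrightarrow> G = H"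
    unfolding I_intervals_def by (elim CollectE exE conjE) (metis IntD1 IntD2 IntI PowD PowI)
  obtain i where i: "i \<in> {1..<k}" "G \<subseteq> F i" using G(3) by (auto simp: earlier_complex_def)
  have iN: "i \<in> {1..N}" "i < k" using i(1) k by simp_all
  obtain c where c: "c \<in> {1..<k}" "F i \<inter> F k \<subseteq> F c"
    and conv: "\<forall>x \<in> F k - F c. \<forall>z \<in> F k - F c. \<forall>y \<in> F k. x \<le> y \<and> y \<le> z \<longrightarrow> y \<notin> F c"
    using lexicographic_swap[OF lex iN(1) k iN(2)] by (elim bexE conjE)
  have "F c \<inter> F k \<in> earlier_complex F k" using c(1) by (auto simp: earlier_complex_def)
  then have "G = F c \<inter> F k" using c(2) i(2) G(2) by (intro max) blast+
  then have A: "A = F k - F c" using G(1) by blast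
  show "A \<subseteq> F k" using A by blast
  show "A \<noteq> {}"
  proof
    assume "A = {}"
    then have "F k \<subseteq> F c" using A by blast
    have "bij_betw F {1..N} facets" using lex by (simp add: lexicographic_order_def)
    then have im: "F ` {1..N} = facets" and inj: "inj_on F {1..N}" by (simp_all add: bij_betw_def)
    have cN: "c \<in> {1..N}" using c(1) k by simp
    have "F k = F c"
      using \<open>F k \<subseteq> F c\<close> im k cN by (intro facet_subset_eq) blast+
    then show False using inj_onD[OF inj _ k cN] c(1) by simp
  qed
  fix x z y assume xyz: "x \<in> A" "z \<in> A" "y \<in> F k" "x \<le> y \<and> y \<le> z"
  then have "y \<notin> F c" using conv[rule_format, of x z y] A by simp
  then show "y \<in> A" using A xyz(3) by blast
next
  fix A B assume AB: "A \<in> I_intervals F k" "B \<in> I_intervals F k" "A \<subseteq> B"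
  let ?E = "Pow (F k) \<inter> earlier_complex F k"
  obtain G where G: "A = F k - G" "G \<in> ?E" using AB(1) unfolding I_intervals_def by blast
  obtain H where H: "B = F k - H" "H \<in> ?E" "\<forall>G \<in> ?E. H \<subseteq> G \<longrightarrow> H = G"
    using AB(2) unfolding I_intervals_def by (elim CollectE exE conjE) (rule that)
  have "H \<subseteq> G" using AB(3) G(1) H(1,2) by blast
  then have "H = G" by (rule H(3)[rule_format, OF G(2)])
  then show "A = B" unfolding G(1) H(1) by simp
qed

section \<open>Critical cells\<close>

locale selected_intervals = chain_intervals V I for V :: "'a::order set" and I +
  fixes js :: "'a set list"
  assumes selects: "selects I js"
begin

definition new :: "'a set set" where
  "new = {h. h \<subseteq> V \<and> hits h I}"

text \<open>The new faces with \<open>\<tau> > k\<close>: list positions start at 0, indices of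
  intervals at 1. Level 0 is all of \<open>new\<close>, level \<open>length js\<close> means
  infinite \<open>\<tau>\<close>.\<close>

definition exact_below :: "nat \<Rightarrow> 'a set set" where
  "exact_below k = {h \<in> new. \<forall>l < k. exact_on h (js ! l)}"

lemma lowest_in: "k < length js \<Longrightarrow> lowest (js ! k) \<in> js ! k"
  by (rule selects_lowest_in[OF selects system nth_mem])

lemma nth_subset: "k < length js \<Longrightarrow> js ! k \<subseteq> V"
  by (rule selects_subset_V[OF selects system nth_mem])

lemma increasing: "k < l \<Longrightarrow> l < length js \<Longrightarrow> x \<in> js ! k \<Longrightarrow> y \<in> js ! l \<Longrightarrow> x < y"
  by (rule selects_increasing[OF selects system])

lemma disjoint:
  assumes "k < length js" "l < length js" "x \<in> js ! k" "x \<in> js ! l"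
  shows "k = l"
  using increasing[of k l x x] increasing[of l k x x] assms by (metis less_irrefl nat_neq_iff)

lemma lowest_le_iff:
  assumes "k < length js" "l < length js"
  shows "lowest (js ! k) \<le> lowest (js ! l) \<longleftrightarrow> k \<le> l"
proof (cases k l rule: linorder_cases)
  case less
  then show ?thesis using increasing[OF less assms(2) lowest_in lowest_in] assms by (simp add: less_imp_le)
next
  case greater
  then show ?thesis using increasing[OF greater assms(1) lowest_in lowest_in] assms by (simp add: leD)
qed simp

lemma inj_nth: "inj_on ((!) js) {..<length js}"
proof (rule inj_onI)
  fix k l assume "k \<in> {..<length js}" "l \<in> {..<length js}" "js ! k = js ! l"
  then show "k = l" using disjoint[of k l "lowest (js ! k)"] lowest_in[of k] by simp
qed

lemma set_js: "set js = (!) js ` {..<length js}"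
  by (auto simp: set_conv_nth)

lemma card_set_js: "card (set js) = length js"
  unfolding set_js by (simp add: card_image[OF inj_nth])

lemma card_lowest_le:
  assumes "k < length js"
  shows "card {B \<in> set js. lowest B \<le> lowest (js ! k)} = Suc k"
proof -
  have "{B \<in> set js. lowest B \<le> lowest (js ! k)} = (!) js ` {..k}"
  proof (intro equalityI subsetI)
    fix B assume "B \<in> {B \<in> set js. lowest B \<le> lowest (js ! k)}"
    then obtain l where "l < length js" "B = js ! l" "lowest (js ! l) \<le> lowest (js ! k)"
      by (auto simp: in_set_conv_nth)
    then show "B \<in> (!) js ` {..k}" using lowest_le_iff[OF _ assms] by simp
  next
    fix B assume "B \<in> (!) js ` {..k}"
    then obtain l where "l \<le> k" "B = js ! l" by auto
    then show "B \<in> {B \<in> set js. lowest B \<le> lowest (js ! k)}"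
      using lowest_le_iff[OF _ assms, of l] assms by simp
  qed
  moreover have "inj_on ((!) js) {..k}" by (rule inj_on_subset[OF inj_nth]) (use assms in auto)
  ultimately show ?thesis by (simp add: card_image)
qed

lemma nth_interval_eq:
  assumes "k < length js"
  shows "nth_interval (set js) (Suc k) = js ! k"
  unfolding nth_interval_def
proof (rule the_equality)
  fix A assume A: "A \<in> set js \<and> card {B \<in> set js. lowest B \<le> lowest A} = Suc k"
  then obtain l where l: "l < length js" "A = js ! l" by (auto simp: in_set_conv_nth)
  then have "l = k" using A card_lowest_le[OF l(1)] by simp
  then show "A = js ! k" using l(2) by simp
qed (use assms card_lowest_le in simp)

lemma tau_set_eq: "tau_set (set js) h = Suc ` {k. k < length js \<and> \<not> exact_on h (js ! k)}"
proof (intro equalityI subsetI)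
  fix i assume "i \<in> tau_set (set js) h"
  then have i: "i \<in> {1..length js}" "h \<inter> nth_interval (set js) i \<noteq> {rho (set js) i}"
    by (simp_all add: tau_set_def card_set_js)
  obtain k where k: "i = Suc k" "k < length js" using i(1) by (cases i) auto
  then show "i \<in> Suc ` {k. k < length js \<and> \<not> exact_on h (js ! k)}"
    using i(2) nth_interval_eq[OF k(2)] by (simp add: rho_def exact_on_def)
next
  fix i assume "i \<in> Suc ` {k. k < length js \<and> \<not> exact_on h (js ! k)}"
  then obtain k where k: "i = Suc k" "k < length js" "\<not> exact_on h (js ! k)" by blast
  then show "i \<in> tau_set (set js) h"
    using nth_interval_eq[OF k(2)] by (simp add: tau_set_def card_set_js rho_def exact_on_def)
qed

lemma tau_set_empty_iff:
  assumes "h \<in> new"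
  shows "tau_set (set js) h = {} \<longleftrightarrow> h \<in> exact_below (length js)"
  using assms unfolding tau_set_eq exact_below_def by auto

lemma toggle_tau_cases:
  assumes "tau_set (set js) h \<noteq> {}" "h \<in> new"
  obtains k where "k < length js" "h \<in> exact_below k" "\<not> exact_on h (js ! k)"
    "rho (set js) (Min (tau_set (set js) h)) = lowest (js ! k)"
proof -
  have fin: "finite (tau_set (set js) h)" by (simp add: tau_set_def)
  obtain k where k: "Min (tau_set (set js) h) = Suc k" "k < length js" "\<not> exact_on h (js ! k)"
    using Min_in[OF fin assms(1)] unfolding tau_set_eq by blast
  have "exact_on h (js ! l)" if "l < k" for l
  proof (rule ccontr)
    assume "\<not> exact_on h (js ! l)"
    then have "Suc l \<in> tau_set (set js) h" using that k(2) by (simp add: tau_set_eq)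
    then have "Suc k \<le> Suc l" using Min_le[OF fin] k(1) by metis
    then show False using that by simp
  qed
  then have "h \<in> exact_below k" using assms(2) by (simp add: exact_below_def)
  then show ?thesis using k nth_interval_eq[OF k(2)] by (intro that[of k]) (simp_all add: rho_def)
qed

text \<open>Earlier intervals do not contain the toggled vertex. The \<open>k\<close>-th one is met
  but not exactly, so it holds a further element of \<open>h\<close>, which keeps it inexact after
  the toggle.\<close>

lemma toggle_exact_below:
  assumes "k < length js" "h \<in> exact_below k" "\<not> exact_on h (js ! k)"
  shows "toggle (lowest (js ! k)) h \<in> exact_below k" "\<not> exact_on (toggle (lowest (js ! k)) h) (js ! k)"
proof -
  let ?v = "lowest (js ! k)"
  have h: "h \<subseteq> V" "hits h I" "\<And>l. l < k \<Longrightarrow> exact_on h (js ! l)"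
    using assms(2) by (simp_all add: exact_below_def new_def)
  have v: "?v \<in> js ! k" by (rule lowest_in[OF assms(1)])
  have "hits (toggle ?v h) I"
    by (rule selects_hits_toggle[OF selects system assms(1) h(3,2) assms(3)])
  moreover have "toggle ?v h \<subseteq> V" using h(1) v nth_subset[OF assms(1)] by (auto simp: toggle_def)
  moreover have "exact_on (toggle ?v h) (js ! l)" if "l < k" for l
  proof -
    have "?v \<notin> js ! l" using disjoint[OF assms(1) _ v, of l] that assms(1) by auto
    then have "toggle ?v h \<inter> js ! l = h \<inter> js ! l" by (auto simp: toggle_def)
    then show ?thesis using h(3)[OF that] by (simp add: exact_on_def)
  qed
  ultimately show "toggle ?v h \<in> exact_below k" by (simp add: exact_below_def new_def)
  have "h \<inter> js ! k \<noteq> {}" by (rule selects_meets[OF selects system assms(1) h(3,2)])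
  moreover have "h \<inter> js ! k \<noteq> {?v}" using assms(3) by (simp add: exact_on_def)
  ultimately have "\<not> h \<inter> js ! k \<subseteq> {?v}" using subset_singletonD by metis
  then obtain x where "x \<in> h" "x \<in> js ! k" "x \<noteq> ?v" by blast
  then have "x \<in> toggle ?v h \<inter> js ! k" "x \<noteq> ?v" by (simp_all add: toggle_def)
  then show "\<not> exact_on (toggle ?v h) (js ! k)" unfolding exact_on_def by blast
qed

lemma in_new_if_exact:
  assumes "h \<subseteq> V" "\<And>k. k < length js \<Longrightarrow> exact_on h (js ! k)"
  shows "h \<in> exact_below (length js)"
proof -
  have "exact_on h j" if "j \<in> set js" for j using that assms(2) by (auto simp: in_set_conv_nth)
  then have "hits h I" by (rule selects_exact_hits[OF selects system])
  then show ?thesis using assms by (simp add: exact_below_def new_def)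
qed

lemma toggle_uncovered:
  assumes "h \<in> exact_below (length js)" "v \<in> V" "v \<notin> \<Union>(set js)"
  shows "toggle v h \<in> exact_below (length js)"
proof (rule in_new_if_exact)
  show "toggle v h \<subseteq> V" using assms(1,2) by (auto simp: toggle_def exact_below_def new_def)
  fix k assume k: "k < length js"
  have "v \<notin> js ! k" using assms(3) nth_mem[OF k] by blast
  then have "toggle v h \<inter> js ! k = h \<inter> js ! k" by (auto simp: toggle_def)
  then show "exact_on (toggle v h) (js ! k)" using assms(1) k by (simp add: exact_on_def exact_below_def)
qed

text \<open>A new subface still meets each earlier interval, but inside the singleton in which
  \<open>h\<close> meets it. This makes each level, joined with the old complex,
  face-closed.\<close>

lemma exact_below_subface:
  assumes "h \<in> exact_below k" "k \<le> length js" "g \<subseteq> h" "g \<in> new"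
  shows "g \<in> exact_below k"
proof -
  have "exact_on g (js ! l)" if "l < k" for l
    using that
  proof (induction l rule: less_induct)
    case (less l)
    have "g \<inter> js ! l \<noteq> {}"
      by (rule selects_meets[OF selects system])
        (use less assms in \<open>auto simp: new_def\<close>)
    moreover have "h \<inter> js ! l = {lowest (js ! l)}"
      using assms(1) less.prems by (simp add: exact_below_def exact_on_def)
    moreover have "g \<inter> js ! l \<subseteq> h \<inter> js ! l" using assms(3) by blast
    ultimately show ?case unfolding exact_on_def by (metis subset_singletonD)
  qed
  then show ?thesis using assms(4) by (simp add: exact_below_def)
qed

definition critical_face :: "'a set" where
  "critical_face = lowest ` set js"

lemma critical_face_exact: "critical_face \<in> exact_below (length js)"
proof (rule in_new_if_exact)
  have "lowest (js ! k) \<in> V" if "k < length js" for k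
    using lowest_in[OF that] nth_subset[OF that] by blast
  then show "critical_face \<subseteq> V" by (auto simp: critical_face_def in_set_conv_nth)
  fix k assume k: "k < length js"
  have "x = lowest (js ! k)" if "x \<in> critical_face" "x \<in> js ! k" for x
  proof -
    obtain l where "l < length js" "x = lowest (js ! l)"
      using \<open>x \<in> critical_face\<close> by (auto simp: critical_face_def in_set_conv_nth)
    then show ?thesis using disjoint[OF _ k lowest_in] \<open>x \<in> js ! k\<close> by metis
  qed
  moreover have "lowest (js ! k) \<in> critical_face" using nth_mem[OF k] by (simp add: critical_face_def)
  ultimately show "exact_on critical_face (js ! k)"
    using lowest_in[OF k] unfolding exact_on_def by blast
qed

text \<open>A covered face is the union of its intersections with the selected intervals, and
  exactness fixes all of these.\<close>

lemma exact_below_covered: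
  assumes "V \<subseteq> \<Union>(set js)"
  shows "exact_below (length js) = {critical_face}"
proof -
  have "h = (\<Union>k < length js. h \<inter> js ! k)" if "h \<subseteq> V" for h
    using that assms unfolding set_js by blast
  moreover have "(\<Union>k < length js. h \<inter> js ! k) = (\<Union>k < length js. {lowest (js ! k)})"
    if "h \<in> exact_below (length js)" for h
    using that by (intro SUP_cong refl) (simp add: exact_below_def exact_on_def)
  ultimately have "h = (\<Union>k < length js. {lowest (js ! k)})" if "h \<in> exact_below (length js)" for h
    using that unfolding exact_below_def new_def by (metis (no_types, lifting) mem_Collect_eq)
  then show ?thesis using critical_face_exact by blast
qed

lemma lowest_uncovered:
  assumes "\<exists>v \<in> V. v \<notin> \<Union>S"
  shows "lowest_uncovered V S \<in> V" "lowest_uncovered V S \<notin> \<Union>S"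
proof -
  have "lowest_uncovered V S = lowest {v \<in> V. v \<notin> \<Union>S}"
    by (simp add: lowest_uncovered_def lowest_def)
  moreover have "lowest {v \<in> V. v \<notin> \<Union>S} \<in> {v \<in> V. v \<notin> \<Union>S}"
    by (rule lowest(1)) (use assms in auto)
  ultimately show "lowest_uncovered V S \<in> V" "lowest_uncovered V S \<notin> \<Union>S" by simp_all
qed

lemma toggle_uncovered_new:
  assumes "h \<in> new" "v \<in> V" "v \<notin> \<Union>I"
  shows "toggle v h \<in> new"
proof -
  have "toggle v h \<inter> A = h \<inter> A" if "A \<in> I" for A
    using assms(3) that by (auto simp: toggle_def)
  then have "hits (toggle v h) I" using assms(1) by (simp add: hits_def new_def)
  moreover have "toggle v h \<subseteq> V" using assms(1,2) by (auto simp: toggle_def new_def)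
  ultimately show ?thesis by (simp add: new_def)
qed

lemma Union_js_subset: "\<Union>(set js) \<subseteq> \<Union>I"
  using selects_subset[OF selects system] by blast

end

section \<open>The levels of \<open>\<tau>\<close> and the homotopy type\<close>

lemma attach_collapsible_levels:
  fixes V :: "'a::{finite,order} set"
  assumes "selected_intervals V I js"
    and X: "face_closed X" "X \<inter> selected_intervals.new V I = {}" "face_closed (X \<union> selected_intervals.new V I)"
  defines "L \<equiv> selected_intervals.exact_below V I js (length js)"
  shows "realization (X \<union> L) homotopy_equivalent_space realization (X \<union> selected_intervals.new V I)"
    and "face_closed (X \<union> L)" "X \<inter> L = {}"
proof -
  interpret selected_intervals V I js by fact
  have closed: "face_closed (X \<union> exact_below k)" if k: "k \<le> length js" for k
    unfolding face_closed_def
  proof (intro ballI subsetI)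
    fix h g assume h: "h \<in> X \<union> exact_below k" and g: "g \<in> Pow h"
    show "g \<in> X \<union> exact_below k"
    proof (cases "h \<in> X")
      case True
      then show ?thesis using face_closedD[OF X(1), of h g] g by blast
    next
      case False
      then have hk: "h \<in> exact_below k" using h by blast
      then have "h \<in> X \<union> new" by (simp add: exact_below_def)
      then have "g \<in> X \<union> new" using face_closedD[OF X(3), of h g] g by blast
      then show ?thesis using exact_below_subface[OF hk k] g by blast
    qed
  qed
  have disj: "X \<inter> exact_below k = {}" for k using X(2) by (auto simp: exact_below_def)
  show "face_closed (X \<union> L)" "X \<inter> L = {}" using closed[of "length js"] disj by (simp_all add: L_def)
  have "realization (X \<union> exact_below k) homotopy_equivalent_space realization (X \<union> new)" if "k \<le> length js" for k
    using that
  proof (induction k)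
    case 0
    have "exact_below 0 = new" by (simp add: exact_below_def)
    then show ?case by (simp add: homotopy_equivalent_space_refl)
  next
    case (Suc k)
    \<comment> \<open>The faces lost between the two levels are those with
      \<open>\<tau> = Suc k\<close>, all toggled at one vertex.\<close>
    have diff: "h \<in> (X \<union> exact_below k) - (X \<union> exact_below (Suc k)) \<longleftrightarrow>
        h \<in> exact_below k \<and> \<not> exact_on h (js ! k)" for h
    proof -
      have "h \<in> exact_below (Suc k) \<longleftrightarrow> h \<in> exact_below k \<and> exact_on h (js ! k)"
        by (auto simp: exact_below_def less_Suc_eq)
      then show ?thesis using disj[of k] by blast
    qed
    have "realization (X \<union> exact_below (Suc k)) homotopy_equivalent_space realization (X \<union> exact_below k)"
    proof (rule collapse_matched_by_vertex)
      show "X \<union> exact_below (Suc k) \<subseteq> X \<union> exact_below k" by (auto simp: exact_below_def)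
      show "toggle (lowest (js ! k)) h \<in> (X \<union> exact_below k) - (X \<union> exact_below (Suc k))"
        if "h \<in> (X \<union> exact_below k) - (X \<union> exact_below (Suc k))" for h
        using that toggle_exact_below[of k h] Suc.prems unfolding diff by simp
    qed (use closed[of k] closed[of "Suc k"] Suc.prems in simp_all)
    then show ?case using Suc by (meson Suc_leD homotopy_eqv_trans)
  qed
  then show "realization (X \<union> L) homotopy_equivalent_space realization (X \<union> new)" by (simp add: L_def)
qed

lemma homotopy_type_changes_iff_covered:
  fixes V :: "'a::{finite,order} set"
  assumes sel: "selected_intervals V I js"
    and X: "face_closed X" "X \<inter> selected_intervals.new V I = {}" "face_closed (X \<union> selected_intervals.new V I)"
  shows "\<not> realization X homotopy_equivalent_space realization (X \<union> selected_intervals.new V I)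
    \<longleftrightarrow> V \<subseteq> \<Union>(set js)"
proof -
  interpret selected_intervals V I js by fact
  define L where "L = exact_below (length js)"
  note levels = attach_collapsible_levels[OF assms, folded L_def]
  show ?thesis
  proof (cases "V \<subseteq> \<Union>(set js)")
    case True
    then have L: "L = {critical_face}" by (simp add: L_def exact_below_covered)
    have "\<not> realization X homotopy_equivalent_space realization (insert critical_face X)"
      using levels(2,3) by (intro realization_attachment_not_homotopy_equivalent X(1)) (simp_all add: L)
    moreover have "realization (insert critical_face X) homotopy_equivalent_space realization (X \<union> new)"
      using levels(1) by (simp add: L)
    ultimately have "\<not> realization X homotopy_equivalent_space realization (X \<union> new)"
      by (meson homotopy_equivalent_space_sym homotopy_eqv_trans)
    then show ?thesis using True by simp
  next
    case False
    then obtain v where v: "v \<in> V" "v \<notin> \<Union>(set js)" by blast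
    \<comment> \<open>Any uncovered vertex pairs up the faces with infinite \<open>\<tau>\<close>,
      which gives one last collapse onto \<open>X\<close>.\<close>
    have "realization X homotopy_equivalent_space realization (X \<union> L)"
    proof (rule collapse_matched_by_vertex[OF X(1) levels(2)])
      show "toggle v h \<in> (X \<union> L) - X" if "h \<in> (X \<union> L) - X" for h
        using that toggle_uncovered[OF _ v, of h] levels(3) unfolding L_def by blast
    qed simp
    then have "realization X homotopy_equivalent_space realization (X \<union> new)"
      using levels(1) by (rule homotopy_eqv_trans)
    then show ?thesis using False by simp
  qed
qed

section \<open>Matched and critical faces of a facet\<close>

lemma selected_intervals_facet:
  fixes F :: "nat \<Rightarrow> 'a::{finite,order_bot,order_top} set"
  assumes lex: "lexicographic_order F N" and k: "k \<in> {1..N}"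
  obtains js where "selected_intervals (F k) (I_intervals F k) js" "set js = J_intervals F k"
proof -
  have "F ` {1..N} = facets" using lex by (simp add: lexicographic_order_def bij_betw_def)
  then interpret finite_chain "F k" using k by (intro finite_chain_facet) blast
  have sys: "interval_system (F k) (I_intervals F k)" by (rule I_intervals_system[OF lex k])
  then obtain js where js: "selects (I_intervals F k) js" using ex_selects by blast
  show ?thesis
  proof (rule that)
    show "selected_intervals (F k) (I_intervals F k) js" by unfold_locales (rule sys js)+
    show "set js = J_intervals F k" by (simp add: J_intervals_def disjoint_intervals_selects[OF js])
  qed
qed

text \<open>Each toggle keeps a face new and in its class of finite or infinite
  \<open>\<tau>\<close>, so the pairs cover whole classes of new faces and nothing else.\<close>

lemma Union_matching_pairs:
  fixes F :: "nat \<Rightarrow> 'a::{finite,order_bot,order_top} set"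
  assumes lex: "lexicographic_order F N" and k: "k \<in> {1..N}"
    and sel: "selected_intervals (F k) (I_intervals F k) js" and J: "set js = J_intervals F k"
  shows "\<Union>(matching_pairs F k) = new_faces F k -
    (if F k \<subseteq> \<Union>(J_intervals F k) then {selected_intervals.critical_face js} else {})"
proof -
  interpret selected_intervals "F k" "I_intervals F k" js by fact
  let ?I = "I_intervals F k" and ?J = "J_intervals F k"
  have new: "new_faces F k = new" by (simp add: new_def new_faces_eq_hits)
  have sub: "\<Union>?J \<subseteq> \<Union>?I" using Union_js_subset by (simp add: J)
  show ?thesis
  proof (cases "\<exists>v \<in> F k. v \<notin> \<Union>?I")
    case True
    let ?v = "lowest_uncovered (F k) ?I"
    have v: "?v \<in> F k" "?v \<notin> \<Union>?I" by (rule lowest_uncovered[OF True])+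
    have M: "matching_pairs F k = {{h - {?v}, h} | h. h \<in> new \<and> ?v \<in> h}"
      using True by (simp add: matching_pairs_def Let_def new)
    have "\<Union>(matching_pairs F k) = new"
    proof (intro equalityI subsetI)
      fix g assume "g \<in> \<Union>(matching_pairs F k)"
      then obtain h where h: "h \<in> new" "?v \<in> h" "g = h - {?v} \<or> g = h" unfolding M by blast
      then show "g \<in> new" using toggle_uncovered_new[OF h(1) v] by (auto simp: toggle_def)
    next
      fix g assume g: "g \<in> new"
      define h where "h = insert ?v g"
      have "h \<in> new"
        using toggle_uncovered_new[OF g v] g by (cases "?v \<in> g") (simp_all add: toggle_def h_def insert_absorb)
      moreover have "g = h - {?v} \<or> g = h" by (auto simp: h_def)
      ultimately show "g \<in> \<Union>(matching_pairs F k)" unfolding M h_def by blast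
    qed
    \<comment> \<open>Case (i) leaves no face unmatched; the formula agrees because a vertex outside
      \<open>I\<close> is outside \<open>J\<close> as well.\<close>
    moreover have "\<not> F k \<subseteq> \<Union>?J" using True sub by blast
    ultimately show ?thesis by (simp add: new)
  next
    case False
    let ?t = "\<lambda>h. toggle (rho ?J (Min (tau_set ?J h))) h"
    let ?u = "\<lambda>h. toggle (lowest_uncovered (F k) ?J) h"
    have M: "matching_pairs F k = {{h, ?t h} | h. h \<in> new \<and> tau_set ?J h \<noteq> {}} \<union>
        {{h, ?u h} | h. h \<in> new \<and> tau_set ?J h = {} \<and> (\<exists>v \<in> F k. v \<notin> \<Union>?J)}"
      unfolding matching_pairs_def Let_def new if_not_P[OF False] ..
    have t: "?t h \<in> new \<and> tau_set ?J (?t h) \<noteq> {}" if h: "h \<in> new" "tau_set ?J h \<noteq> {}" for h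
    proof -
      obtain l where l: "l < length js" "h \<in> exact_below l" "\<not> exact_on h (js ! l)"
        "rho (set js) (Min (tau_set (set js) h)) = lowest (js ! l)"
        by (rule toggle_tau_cases[OF h(2)[folded J] h(1)])
      then have "?t h \<in> exact_below l" "\<not> exact_on (?t h) (js ! l)"
        using toggle_exact_below[OF l(1-3)] by (simp_all add: J)
      then have "?t h \<in> new" "Suc l \<in> tau_set (set js) (?t h)"
        using l(1) by (simp_all add: exact_below_def tau_set_eq)
      then show ?thesis by (auto simp: J)
    qed
    have u: "?u h \<in> exact_below (length js)"
      if "h \<in> exact_below (length js)" "\<exists>v \<in> F k. v \<notin> \<Union>?J" for h
      using that(1) lowest_uncovered[OF that(2)] by (intro toggle_uncovered) (simp_all add: J)
    have e: "tau_set ?J h = {} \<longleftrightarrow> h \<in> exact_below (length js)" if "h \<in> new" for h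
      using tau_set_empty_iff[OF that] by (simp add: J)
    have en: "exact_below (length js) \<subseteq> new" by (auto simp: exact_below_def)
    show ?thesis
    proof (cases "F k \<subseteq> \<Union>?J")
      case True
      then have c: "exact_below (length js) = {critical_face}" by (intro exact_below_covered) (simp add: J)
      have "\<Union>(matching_pairs F k) = {h \<in> new. tau_set ?J h \<noteq> {}}"
      proof (intro equalityI subsetI)
        fix g assume "g \<in> \<Union>(matching_pairs F k)"
        then obtain h where h: "h \<in> new" "tau_set ?J h \<noteq> {}" "g = h \<or> g = ?t h" using True unfolding M by blast
        from h(3) show "g \<in> {h \<in> new. tau_set ?J h \<noteq> {}}"
        proof
          assume "g = h"
          then show ?thesis using h(1,2) by simp
        next
          assume "g = ?t h"
          then show ?thesis using t[OF h(1,2)] by simp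
        qed
      next
        fix g assume "g \<in> {h \<in> new. tau_set ?J h \<noteq> {}}"
        then have "{g, ?t g} \<in> matching_pairs F k" unfolding M by blast
        then show "g \<in> \<Union>(matching_pairs F k)" by (rule UnionI) simp
      qed
      also have "\<dots> = new - {critical_face}"
      proof (intro equalityI subsetI)
        fix g assume "g \<in> {h \<in> new. tau_set ?J h \<noteq> {}}"
        then show "g \<in> new - {critical_face}" using e[of g] c by simp
      next
        fix g assume "g \<in> new - {critical_face}"
        then show "g \<in> {h \<in> new. tau_set ?J h \<noteq> {}}" using e[of g] c by simp
      qed
      finally show ?thesis using True by (simp add: new)
    next
      case nc: False
      have "\<Union>(matching_pairs F k) = new"
      proof (intro equalityI subsetI)
        fix g assume "g \<in> \<Union>(matching_pairs F k)"
        then consider h where "h \<in> new" "tau_set ?J h \<noteq> {}" "g = h \<or> g = ?t h"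
          | h where "h \<in> new" "tau_set ?J h = {}" "\<exists>v \<in> F k. v \<notin> \<Union>?J" "g = h \<or> g = ?u h"
          unfolding M by blast
        then show "g \<in> new"
        proof cases
          case 1
          then show ?thesis using t[OF 1(1,2)] by (elim disjE) simp_all
        next
          case 2
          have "h \<in> exact_below (length js)" using e[OF 2(1)] 2(2) by simp
          then have "?u h \<in> new" using u[OF _ 2(3)] en by blast
          then show ?thesis using 2(1,4) by (elim disjE) simp_all
        qed
      next
        fix g assume g: "g \<in> new"
        show "g \<in> \<Union>(matching_pairs F k)"
        proof (cases "tau_set ?J g = {}")
          case True
          then have "{g, ?u g} \<in> matching_pairs F k" using nc g unfolding M by blast
          then show ?thesis by (rule UnionI) simp
        next
          case False
          then have "{g, ?t g} \<in> matching_pairs F k" using g unfolding M by blast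
          then show ?thesis by (rule UnionI) simp
        qed
      qed
      then show ?thesis using nc by (simp add: new)
    qed
  qed
qed

lemma new_faces_disjoint:
  assumes "k \<noteq> l" "k \<ge> 1" "l \<ge> 1"
  shows "new_faces F k \<inter> new_faces F l = {}"
proof -
  have "new_faces F k \<inter> new_faces F l = {}" if "k < l" "k \<ge> 1" for k l :: nat
    using that by (auto simp: new_faces_def earlier_complex_def)
  then show ?thesis using assms by (metis inf_commute nat_neq_iff)
qed

lemma earlier_complex_Suc:
  assumes "k \<ge> 1"
  shows "earlier_complex F (Suc k) = earlier_complex F k \<union> new_faces F k"
proof -
  have "{1..<Suc k} = insert k {1..<k}" using assms by auto
  then show ?thesis by (auto simp: earlier_complex_def new_faces_def)
qed

text \<open>Pairs of another facet consist of its own new faces, which are disjoint from those of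
  \<open>F k\<close>; so only \<open>matching_pairs F k\<close> counts.\<close>

lemma critical_cells_new_faces:
  fixes F :: "nat \<Rightarrow> 'a::{finite,order_bot,order_top} set"
  assumes lex: "lexicographic_order F N" and k: "k \<in> {1..N}"
    and sel: "selected_intervals (F k) (I_intervals F k) js" and J: "set js = J_intervals F k"
  shows "critical_cells F N \<inter> new_faces F k =
    (if F k \<subseteq> \<Union>(J_intervals F k) then {selected_intervals.critical_face js} else {})"
proof -
  interpret selected_intervals "F k" "I_intervals F k" js by fact
  have "F ` {1..N} = facets" using lex by (simp add: lexicographic_order_def bij_betw_def)
  then have "F k \<in> order_complex" using k by (auto simp: facets_def)
  then have oc: "new_faces F k \<subseteq> order_complex"
    by (auto simp: order_complex_def new_faces_def chain_def)
  have other: "\<Union>(matching_pairs F l) \<inter> new_faces F k = {}" if l: "l \<in> {1..N}" "l \<noteq> k" for l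
  proof -
    obtain ls where "selected_intervals (F l) (I_intervals F l) ls" "set ls = J_intervals F l"
      by (rule selected_intervals_facet[OF lex l(1)])
    then have "\<Union>(matching_pairs F l) \<subseteq> new_faces F l"
      using Union_matching_pairs[OF lex l(1)] by simp
    then show ?thesis using new_faces_disjoint[of l k F] l k by auto
  qed
  have "h \<in> \<Union>(\<Union>l \<in> {1..N}. matching_pairs F l) \<longleftrightarrow> h \<in> \<Union>(matching_pairs F k)" if "h \<in> new_faces F k" for h
    using other that k by blast
  then have "critical_cells F N \<inter> new_faces F k = new_faces F k - \<Union>(matching_pairs F k)"
    using oc unfolding critical_cells_def by blast
  also have "\<dots> = (if F k \<subseteq> \<Union>(J_intervals F k) then {critical_face} else {})"
  proof -
    have "critical_face \<in> new" using critical_face_exact by (simp add: exact_below_def)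
    then have "critical_face \<in> new_faces F k" by (simp add: new_def new_faces_eq_hits)
    then show ?thesis unfolding Union_matching_pairs[OF assms] by auto
  qed
  finally show ?thesis .
qed

lemma attachment_changes_iff_covered:
  fixes F :: "nat \<Rightarrow> 'a::{finite,order_bot,order_top} set"
  assumes k: "k \<in> {1..N}"
    and sel: "selected_intervals (F k) (I_intervals F k) js" and J: "set js = J_intervals F k"
  shows "attachment_changes_homotopy_type F k \<longleftrightarrow> F k \<subseteq> \<Union>(J_intervals F k)"
proof -
  interpret selected_intervals "F k" "I_intervals F k" js by fact
  have new: "new_faces F k = new" by (simp add: new_def new_faces_eq_hits)
  have Suc: "earlier_complex F (Suc k) = earlier_complex F k \<union> new"
    using earlier_complex_Suc[of k F] k by (simp add: new)
  have "earlier_complex F k \<inter> new = {}" by (auto simp flip: new simp: new_faces_def)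
  then show ?thesis
    using homotopy_type_changes_iff_covered[OF sel earlier_complex_face_closed[of F k]]
      earlier_complex_face_closed[of F "Suc k"]
    unfolding attachment_changes_homotopy_type_def Suc by (simp add: J)
qed

theorem theorem2p2:
  fixes F :: "nat \<Rightarrow> 'a::{finite,order_bot,order_top} set" and N :: nat
  assumes "lexicographic_order F N"
  shows "\<forall>k \<in> {1..N}.
    card (critical_cells F N \<inter> new_faces F k) \<le> 1 \<and>
    (critical_cells F N \<inter> new_faces F k \<noteq> {} \<longleftrightarrow> attachment_changes_homotopy_type F k) \<and>
    (attachment_changes_homotopy_type F k \<longleftrightarrow> (\<forall>v \<in> F k. \<exists>j \<in> J_intervals F k. v \<in> j))"
proof
  fix k assume k: "k \<in> {1..N}"
  obtain js where js: "selected_intervals (F k) (I_intervals F k) js" "set js = J_intervals F k"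
    by (rule selected_intervals_facet[OF assms k])
  have "F k \<subseteq> \<Union>(J_intervals F k) \<longleftrightarrow> (\<forall>v \<in> F k. \<exists>j \<in> J_intervals F k. v \<in> j)" by blast
  then show "card (critical_cells F N \<inter> new_faces F k) \<le> 1 \<and>
    (critical_cells F N \<inter> new_faces F k \<noteq> {} \<longleftrightarrow> attachment_changes_homotopy_type F k) \<and>
    (attachment_changes_homotopy_type F k \<longleftrightarrow> (\<forall>v \<in> F k. \<exists>j \<in> J_intervals F k. v \<in> j))"
    using critical_cells_new_faces[OF assms k js] attachment_changes_iff_covered[OF k js] by simp
qed

end
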